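(* Let $(\mathcal C,\mathbb E,\mathfrak s)$ be an extriangulated category, and let $(\alpha,\beta,\gamma)$, with $\alpha:X\to X'$, $\beta:Y\to Y'$, $\gamma:Z\to Z'$, be a morphism of $\mathbb E$-triangles from $X\xrightarrow{f}Y\xrightarrow{g}Z\overset{\delta}{\dashrightarrow}$ to $X'\xrightarrow{f'}Y'\xrightarrow{g'}Z'\overset{\delta'}{\dashrightarrow}$. Then there are morphisms $\alpha':X\to X'$, $\beta':Y\to Y'$ and $\gamma':Z\to Z'$ such that $(\alpha',\beta,\gamma)$, $(\alpha,\beta',\gamma)$ and $(\alpha,\beta,\gamma')$ are homotopic morphisms of $\mathbb E$-triangles (between the same two $\mathbb E$-triangles), and such that moreover: (1) If each of $\alpha$ and $\gamma$ is both an $\mathbb E$-inflation and an $\mathbb E$-deflation, then $\beta'$ is both an $\mathbb E$-inflation and an $\mathbb E$-deflation. (2) If $\alpha$ is both an $\mathbb E$-inflation and an $\mathbb E$-deflation and $\gamma$ is an $\mathbb E$-inflation, then $\beta'$ is an $\mathbb E$-inflation. (3) If $\alpha$ is an $\mathbb E$-inflation and $\gamma$ is both an $\mathbb E$-inflation and an $\mathbb E$-deflation, then $\beta'$ is an $\mathbb E$-inflation. (4) If $\alpha$ and $\gamma$ are $\mathbb E$-inflations, then $\beta'$ is an $\mathbb E$-inflation. (5) If each of $\alpha$ and $\beta$ is both an $\mathbb E$-inflation and an $\mathbb E$-deflation, then $\gamma'$ is an $\mathbb E$-deflation. (6) If $\alpha$ is both an $\mathbb E$-inflation and an $\mathbb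 E$-deflation and $\beta$ is an $\mathbb E$-deflation, then $\gamma'$ is an $\mathbb E$-deflation. (7) If $\alpha$ is an $\mathbb E$-inflation and $\beta$ is both an $\mathbb E$-inflation and an $\mathbb E$-deflation, then $\gamma'$ is an $\mathbb E$-deflation. (8) If $\alpha$ is an $\mathbb E$-inflation and $\beta$ is an $\mathbb E$-deflation, then $\gamma'$ is an $\mathbb E$-deflation. If in addition $\mathcal C$ is weakly idempotent complete, then also: (9) If $\alpha$ is an $\mathbb E$-deflation and $\beta$ is both an $\mathbb E$-inflation and an $\mathbb E$-deflation, then $\gamma'$ is an $\mathbb E$-deflation; in this case $\alpha$ is both an $\mathbb E$-inflation and an $\mathbb E$-deflation. (10) If $\alpha$ and $\beta$ are $\mathbb E$-deflations, then $\gamma'$ is an $\mathbb E$-deflation.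
   Context: Extriangulated categories (Nakaoka–Palu). Let $\mathcal C$ be an additive category and $\mathbb E:\mathcal C^{\mathrm{op}}\times\mathcal C\to\mathbf{Ab}$ an additive bifunctor. An element $\delta\in\mathbb E(Z,X)$ is an $\mathbb E$-extension; write $f_*=\mathbb E(-,f)$ and $g^*=\mathbb E(g,-)$. Two sequences $X\to Y\to Z$ and $X\to Y'\to Z$ are equivalent if there is an isomorphism $Y\cong Y'$ compatible with the maps from $X$ and to $Z$. An additive realization $\mathfrak s$ assigns to each $\delta\in\mathbb E(Z,X)$ an equivalence class $\mathfrak s(\delta)=[X\xrightarrow{f}Y\xrightarrow{g}Z]$ such that: (i) if $\delta\in\mathbb E(Z,X)$, $\delta'\in\mathbb E(Z',X')$, $\alpha:X\to X'$, $\gamma:Z\to Z'$ satisfy $\alpha_*\delta=\gamma^*\delta'$, then for any representatives $X\xrightarrow{f}Y\xrightarrow{g}Z$ of $\mathfrak s(\delta)$ and $X'\xrightarrow{f'}Y'\xrightarrow{g'}Z'$ of $\mathfrak s(\delta')$ there is $\beta:Y\to Y'$ with $\beta f=f'\alpha$, $g'\beta=\gamma g$; (ii) $0\in\mathbb E(Z,X)$ is realized by the split sequence $X\to X\oplus Z\to Z$; (iii) $\mathfrak s(\delta\oplus\delta')=\mathfrak s(\delta)\oplus\mathfrak s(\delta')$. If $\mathfrak s(\delta)=[X\xrightarrow{f}Y\xrightarrow{g}Z]$, one writes $X\xrightarrow{f}Y\xrightarrow{g}Z\overset{\delta}{\dashrightarrow}$ and calls it an $\mathbb E$-triangle, $f$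 an $\mathbb E$-inflation, $g$ an $\mathbb E$-deflation. A morphism of $\mathbb E$-triangles from this one to $X'\xrightarrow{f'}Y'\xrightarrow{g'}Z'\overset{\delta'}{\dashrightarrow}$ is a triple $(\alpha,\beta,\gamma)$ with $\beta f=f'\alpha$, $g'\beta=\gamma g$, $\alpha_*\delta=\gamma^*\delta'$. $(\mathcal C,\mathbb E,\mathfrak s)$ is an extriangulated category if moreover: (ET3) for two such $\mathbb E$-triangles and $\alpha,\beta$ with $\beta f=f'\alpha$ there is $\gamma$ making $(\alpha,\beta,\gamma)$ a morphism of $\mathbb E$-triangles; (ET3$^{\mathrm{op}}$) given $\beta,\gamma$ with $\gamma g=g'\beta$ there is $\alpha$ making $(\alpha,\beta,\gamma)$ a morphism of $\mathbb E$-triangles; (ET4) given $\mathbb E$-triangles $A\xrightarrow{f}B\xrightarrow{g}D\overset{\delta}{\dashrightarrow}$ and $B\xrightarrow{u}C\xrightarrow{v}E\overset{\varepsilon}{\dashrightarrow}$ there are $\mathbb E$-triangles $A\xrightarrow{m}C\xrightarrow{h}F\overset{\theta}{\dashrightarrow}$ and $D\xrightarrow{w}F\xrightarrow{q}E\overset{\eta}{\dashrightarrow}$ with $m=uf$, $wg=hu$, $v=qh$, $w^*\theta=\delta$, $g_*\varepsilon=\eta$, $f_*\theta=q^*\varepsilon$; (ET4$^{\mathrm{op}}$) conversely, given the latter two $\mathbb E$-triangles there are $\mathbb E$-triangles of the former form satisfying the same six relations. Homotopic morphisms. A morphism $(\alpha,\beta,\gamma)$ of $\mathbb E$-triangles from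 $X\xrightarrow{f}Y\xrightarrow{g}Z\overset{\delta}{\dashrightarrow}$ to $X'\xrightarrow{f'}Y'\xrightarrow{g'}Z'\overset{\delta'}{\dashrightarrow}$ is homotopic if there are an $\mathbb E$-triangle $X'\xrightarrow{s}E\xrightarrow{t}Z\overset{\eta}{\dashrightarrow}$ and morphisms $\beta_1:Y\to E$, $\beta_2:E\to Y'$ with $\beta=\beta_2\beta_1$, such that $(\alpha,\beta_1,1_Z)$ (from the first $\mathbb E$-triangle to this one) and $(1_{X'},\beta_2,\gamma)$ (from this one to the second) are morphisms of $\mathbb E$-triangles, and $X\xrightarrow{\left(\begin{smallmatrix}f\\ \alpha\end{smallmatrix}\right)}Y\oplus X'\xrightarrow{(\beta_1,-s)}E\overset{t^*\delta}{\dashrightarrow}$ and $E\xrightarrow{\left(\begin{smallmatrix}-t\\ \beta_2\end{smallmatrix}\right)}Z\oplus Y'\xrightarrow{(\gamma,g')}Z'\overset{s_*\delta'}{\dashrightarrow}$ are $\mathbb E$-triangles. An additive category is weakly idempotent complete if every section (split monomorphism) has a cokernel, equivalently every retraction (split epimorphism) has a kernel. *)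

theory Defs
  imports "HOL-Algebra.Ring"
begin

section \<open>Additive categories\<close>

text \<open>
  A category has a carrier \<open>Obj\<close> of objects and pairwise disjoint Hom-sets inside one type \<open>'m\<close>,
  so that composition needs no object arguments. Abelian groups are given by HOL-Algebra's
  locale \<open>abelian_group\<close>; it looks only at \<open>carrier\<close>, \<open>\<oplus>\<close> and \<open>\<zero>\<close> of a \<open>ring\<close> record, and the two
  multiplicative fields of that record are never used below.
  Everything is relativised to the carriers; values outside them are irrelevant.
\<close>

record ('o, 'm) precat =
  Obj :: "'o set"
  hom_group :: "'o \<Rightarrow> 'o \<Rightarrow> 'm ring"
  mcomp :: "'m \<Rightarrow> 'm \<Rightarrow> 'm"  (infixl "\<cdot>\<index>" 75)
  ident :: "'o \<Rightarrow> 'm"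

abbreviation Hom :: "('o, 'm, 'z) precat_scheme \<Rightarrow> 'o \<Rightarrow> 'o \<Rightarrow> 'm set" where
  "Hom C X Y \<equiv> carrier (hom_group C X Y)"

locale category =
  fixes C (structure)
  assumes Hom_disjoint:
      "\<lbrakk>X \<in> Obj C; Y \<in> Obj C; X' \<in> Obj C; Y' \<in> Obj C; f \<in> Hom C X Y; f \<in> Hom C X' Y'\<rbrakk>
        \<Longrightarrow> X = X' \<and> Y = Y'"
    and ident_closed: "X \<in> Obj C \<Longrightarrow> ident C X \<in> Hom C X X"
    and comp_closed:
      "\<lbrakk>X \<in> Obj C; Y \<in> Obj C; Z \<in> Obj C; f \<in> Hom C X Y; g \<in> Hom C Y Z\<rbrakk> \<Longrightarrow> g \<cdot> f \<in> Hom C X Z"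
    and comp_ident_right:
      "\<lbrakk>X \<in> Obj C; Y \<in> Obj C; f \<in> Hom C X Y\<rbrakk> \<Longrightarrow> f \<cdot> ident C X = f"
    and comp_ident_left:
      "\<lbrakk>X \<in> Obj C; Y \<in> Obj C; f \<in> Hom C X Y\<rbrakk> \<Longrightarrow> ident C Y \<cdot> f = f"
    and comp_assoc:
      "\<lbrakk>W \<in> Obj C; X \<in> Obj C; Y \<in> Obj C; Z \<in> Obj C;
        f \<in> Hom C W X; g \<in> Hom C X Y; h \<in> Hom C Y Z\<rbrakk> \<Longrightarrow> (h \<cdot> g) \<cdot> f = h \<cdot> (g \<cdot> f)"

locale preadditive_category = category +
  assumes hom_abelian_group:
      "\<lbrakk>X \<in> Obj C; Y \<in> Obj C\<rbrakk> \<Longrightarrow> abelian_group (hom_group C X Y)"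
    and comp_add_right:
      "\<lbrakk>X \<in> Obj C; Y \<in> Obj C; Z \<in> Obj C; f \<in> Hom C X Y; f' \<in> Hom C X Y; g \<in> Hom C Y Z\<rbrakk>
        \<Longrightarrow> g \<cdot> (f \<oplus>\<^bsub>hom_group C X Y\<^esub> f') = (g \<cdot> f) \<oplus>\<^bsub>hom_group C X Z\<^esub> (g \<cdot> f')"
    and comp_add_left:
      "\<lbrakk>X \<in> Obj C; Y \<in> Obj C; Z \<in> Obj C; f \<in> Hom C X Y; g \<in> Hom C Y Z; g' \<in> Hom C Y Z\<rbrakk>
        \<Longrightarrow> (g \<oplus>\<^bsub>hom_group C Y Z\<^esub> g') \<cdot> f = (g \<cdot> f) \<oplus>\<^bsub>hom_group C X Z\<^esub> (g' \<cdot> f)"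

definition is_zero_object :: "('o, 'm, 'z) precat_scheme \<Rightarrow> 'o \<Rightarrow> bool" where
  "is_zero_object C N \<longleftrightarrow> N \<in> Obj C \<and>
    (\<forall>X \<in> Obj C. (\<exists>!f. f \<in> Hom C X N) \<and> (\<exists>!f. f \<in> Hom C N X))"

text \<open>
  \<open>is_biproduct C A B P i j p q\<close>: the object \<open>P\<close> is a direct sum of \<open>A\<close> and \<open>B\<close>, with injections
  \<open>i : A \<rightarrow> P\<close>, \<open>j : B \<rightarrow> P\<close> and projections \<open>p : P \<rightarrow> A\<close>, \<open>q : P \<rightarrow> B\<close>. No direct sums are
  singled out: a condition mentioning \<open>A \<oplus> B\<close> is required for every choice of direct sum.
\<close>

definition is_biproduct ::
    "('o, 'm, 'z) precat_scheme \<Rightarrow> 'o \<Rightarrow> 'o \<Rightarrow> 'o \<Rightarrow> 'm \<Rightarrow> 'm \<Rightarrow> 'm \<Rightarrow> 'm \<Rightarrow> bool" where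
  "is_biproduct C A B P i j p q \<longleftrightarrow>
    A \<in> Obj C \<and> B \<in> Obj C \<and> P \<in> Obj C \<and>
    i \<in> Hom C A P \<and> j \<in> Hom C B P \<and> p \<in> Hom C P A \<and> q \<in> Hom C P B \<and>
    p \<cdot>\<^bsub>C\<^esub> i = ident C A \<and> q \<cdot>\<^bsub>C\<^esub> j = ident C B \<and>
    q \<cdot>\<^bsub>C\<^esub> i = \<zero>\<^bsub>hom_group C A B\<^esub> \<and> p \<cdot>\<^bsub>C\<^esub> j = \<zero>\<^bsub>hom_group C B A\<^esub> \<and>
    (i \<cdot>\<^bsub>C\<^esub> p) \<oplus>\<^bsub>hom_group C P P\<^esub> (j \<cdot>\<^bsub>C\<^esub> q) = ident C P"

locale additive_category = preadditive_category +
  assumes zero_object_exists: "\<exists>N. is_zero_object C N"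
    and biproduct_exists:
      "\<lbrakk>A \<in> Obj C; B \<in> Obj C\<rbrakk> \<Longrightarrow> \<exists>P i j p q. is_biproduct C A B P i j p q"

definition is_iso :: "('o, 'm, 'z) precat_scheme \<Rightarrow> 'o \<Rightarrow> 'o \<Rightarrow> 'm \<Rightarrow> bool" where
  "is_iso C X Y h \<longleftrightarrow> h \<in> Hom C X Y \<and>
    (\<exists>k \<in> Hom C Y X. k \<cdot>\<^bsub>C\<^esub> h = ident C X \<and> h \<cdot>\<^bsub>C\<^esub> k = ident C Y)"

definition is_section :: "('o, 'm, 'z) precat_scheme \<Rightarrow> 'o \<Rightarrow> 'o \<Rightarrow> 'm \<Rightarrow> bool" where
  "is_section C A B s \<longleftrightarrow> s \<in> Hom C A B \<and> (\<exists>r \<in> Hom C B A. r \<cdot>\<^bsub>C\<^esub> s = ident C A)"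

definition is_cokernel ::
    "('o, 'm, 'z) precat_scheme \<Rightarrow> 'o \<Rightarrow> 'o \<Rightarrow> 'm \<Rightarrow> 'o \<Rightarrow> 'm \<Rightarrow> bool" where
  "is_cokernel C A B s Q c \<longleftrightarrow>
    Q \<in> Obj C \<and> c \<in> Hom C B Q \<and> c \<cdot>\<^bsub>C\<^esub> s = \<zero>\<^bsub>hom_group C A Q\<^esub> \<and>
    (\<forall>D \<in> Obj C. \<forall>h \<in> Hom C B D. h \<cdot>\<^bsub>C\<^esub> s = \<zero>\<^bsub>hom_group C A D\<^esub> \<longrightarrow>
      (\<exists>!k. k \<in> Hom C Q D \<and> k \<cdot>\<^bsub>C\<^esub> c = h))"

definition weakly_idempotent_complete :: "('o, 'm, 'z) precat_scheme \<Rightarrow> bool" where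
  "weakly_idempotent_complete C \<longleftrightarrow>
    (\<forall>A \<in> Obj C. \<forall>B \<in> Obj C. \<forall>s. is_section C A B s \<longrightarrow> (\<exists>Q c. is_cokernel C A B s Q c))"


section \<open>Extensions\<close>

text \<open>
  \<open>Ext C Z X\<close> is the abelian group \<open>\<E>(Z, X)\<close>, and for \<open>g : Z' \<rightarrow> Z\<close> and \<open>f : X \<rightarrow> X'\<close> the map
  \<open>Emap C g f\<close> is \<open>\<E>(g, f) : \<E>(Z, X) \<rightarrow> \<E>(Z', X')\<close>. For \<open>\<delta> \<in> \<E>(Z, X)\<close>, the set \<open>realize C Z X \<delta>\<close>
  is the class \<open>\<s>(\<delta>)\<close>, where a triple \<open>(f, Y, g)\<close> stands for the sequence \<open>X \<rightarrow> Y \<rightarrow> Z\<close> with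
  maps \<open>f\<close> and \<open>g\<close>. The groups for different \<open>Z\<close>, \<open>X\<close> need not be disjoint.
\<close>

record ('o, 'm, 'e) extri = "('o, 'm) precat" +
  Ext :: "'o \<Rightarrow> 'o \<Rightarrow> 'e ring"
  Emap :: "'m \<Rightarrow> 'm \<Rightarrow> 'e \<Rightarrow> 'e"
  realize :: "'o \<Rightarrow> 'o \<Rightarrow> 'e \<Rightarrow> ('m \<times> 'o \<times> 'm) set"

text \<open>
  For \<open>\<delta> \<in> \<E>(Z, X)\<close>, \<open>push C Z f \<delta>\<close> is \<open>f\<^sub>* \<delta>\<close> and \<open>pull C X g \<delta>\<close> is \<open>g\<^sup>* \<delta>\<close>; the object
  argument is the one that stays fixed.
\<close>

definition push :: "('o, 'm, 'e, 'z) extri_scheme \<Rightarrow> 'o \<Rightarrow> 'm \<Rightarrow> 'e \<Rightarrow> 'e" where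
  "push C Z f \<delta> = Emap C (ident C Z) f \<delta>"

definition pull :: "('o, 'm, 'e, 'z) extri_scheme \<Rightarrow> 'o \<Rightarrow> 'm \<Rightarrow> 'e \<Rightarrow> 'e" where
  "pull C X g \<delta> = Emap C g (ident C X) \<delta>"

locale additive_bifunctor = additive_category +
  assumes Ext_abelian_group:
      "\<lbrakk>Z \<in> Obj C; X \<in> Obj C\<rbrakk> \<Longrightarrow> abelian_group (Ext C Z X)"
    and Emap_hom:
      "\<lbrakk>Z \<in> Obj C; Z' \<in> Obj C; X \<in> Obj C; X' \<in> Obj C; g \<in> Hom C Z' Z; f \<in> Hom C X X'\<rbrakk>
        \<Longrightarrow> Emap C g f \<in> hom (add_monoid (Ext C Z X)) (add_monoid (Ext C Z' X'))"
    and Emap_ident: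
      "\<lbrakk>Z \<in> Obj C; X \<in> Obj C; \<delta> \<in> carrier (Ext C Z X)\<rbrakk>
        \<Longrightarrow> Emap C (ident C Z) (ident C X) \<delta> = \<delta>"
    and Emap_comp:
      "\<lbrakk>Z \<in> Obj C; Z' \<in> Obj C; Z'' \<in> Obj C; X \<in> Obj C; X' \<in> Obj C; X'' \<in> Obj C;
        g \<in> Hom C Z' Z; g' \<in> Hom C Z'' Z'; f \<in> Hom C X X'; f' \<in> Hom C X' X'';
        \<delta> \<in> carrier (Ext C Z X)\<rbrakk>
        \<Longrightarrow> Emap C (g \<cdot> g') (f' \<cdot> f) \<delta> = Emap C g' f' (Emap C g f \<delta>)"
    and Emap_add_left:
      "\<lbrakk>Z \<in> Obj C; Z' \<in> Obj C; X \<in> Obj C; X' \<in> Obj C;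
        g \<in> Hom C Z' Z; g' \<in> Hom C Z' Z; f \<in> Hom C X X'; \<delta> \<in> carrier (Ext C Z X)\<rbrakk>
        \<Longrightarrow> Emap C (g \<oplus>\<^bsub>hom_group C Z' Z\<^esub> g') f \<delta> = Emap C g f \<delta> \<oplus>\<^bsub>Ext C Z' X'\<^esub> Emap C g' f \<delta>"
    and Emap_add_right:
      "\<lbrakk>Z \<in> Obj C; Z' \<in> Obj C; X \<in> Obj C; X' \<in> Obj C;
        g \<in> Hom C Z' Z; f \<in> Hom C X X'; f' \<in> Hom C X X'; \<delta> \<in> carrier (Ext C Z X)\<rbrakk>
        \<Longrightarrow> Emap C g (f \<oplus>\<^bsub>hom_group C X X'\<^esub> f') \<delta> = Emap C g f \<delta> \<oplus>\<^bsub>Ext C Z' X'\<^esub> Emap C g f' \<delta>"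


section \<open>Additive realizations\<close>

definition sequences :: "('o, 'm, 'z) precat_scheme \<Rightarrow> 'o \<Rightarrow> 'o \<Rightarrow> ('m \<times> 'o \<times> 'm) set" where
  "sequences C X Z = {(f, Y, g). Y \<in> Obj C \<and> f \<in> Hom C X Y \<and> g \<in> Hom C Y Z}"

definition seq_equiv ::
    "('o, 'm, 'z) precat_scheme \<Rightarrow> 'o \<Rightarrow> 'o \<Rightarrow> (('m \<times> 'o \<times> 'm) \<times> ('m \<times> 'o \<times> 'm)) set" where
  "seq_equiv C X Z = {((f, Y, g), (f', Y', g')).
     (f, Y, g) \<in> sequences C X Z \<and> (f', Y', g') \<in> sequences C X Z \<and>
     (\<exists>h. is_iso C Y Y' h \<and> h \<cdot>\<^bsub>C\<^esub> f = f' \<and> g' \<cdot>\<^bsub>C\<^esub> h = g)}"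

text \<open>
  Since \<open>realize C Z X \<delta>\<close> is an equivalence class, the equation \<open>\<s>(\<delta>) = [X \<rightarrow> Y \<rightarrow> Z]\<close> is membership
  of the sequence in that class.
\<close>

definition etriangle ::
    "('o, 'm, 'e, 'z) extri_scheme \<Rightarrow> 'o \<Rightarrow> 'm \<Rightarrow> 'o \<Rightarrow> 'm \<Rightarrow> 'o \<Rightarrow> 'e \<Rightarrow> bool" where
  "etriangle C X f Y g Z \<delta> \<longleftrightarrow>
    X \<in> Obj C \<and> Y \<in> Obj C \<and> Z \<in> Obj C \<and> f \<in> Hom C X Y \<and> g \<in> Hom C Y Z \<and>
    \<delta> \<in> carrier (Ext C Z X) \<and> (f, Y, g) \<in> realize C Z X \<delta>"

text \<open>
  \<open>f \<oplus> f' : A \<oplus> A' \<rightarrow> B \<oplus> B'\<close>, where \<open>p\<close>, \<open>p'\<close> are the projections of the direct sum \<open>S = A \<oplus> A'\<close> and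
  \<open>i\<close>, \<open>i'\<close> the injections of the direct sum \<open>T = B \<oplus> B'\<close>.
\<close>

definition map_sum ::
    "('o, 'm, 'z) precat_scheme \<Rightarrow> 'o \<Rightarrow> 'm \<Rightarrow> 'm \<Rightarrow> 'o \<Rightarrow> 'm \<Rightarrow> 'm \<Rightarrow> 'm \<Rightarrow> 'm \<Rightarrow> 'm" where
  "map_sum C S p p' T i i' f f' =
    (i \<cdot>\<^bsub>C\<^esub> f \<cdot>\<^bsub>C\<^esub> p) \<oplus>\<^bsub>hom_group C S T\<^esub> (i' \<cdot>\<^bsub>C\<^esub> f' \<cdot>\<^bsub>C\<^esub> p')"

text \<open>
  \<open>\<delta> \<oplus> \<delta>' \<in> \<E>(Z \<oplus> Z', X \<oplus> X')\<close> for \<open>\<delta> \<in> \<E>(Z, X)\<close> and \<open>\<delta>' \<in> \<E>(Z', X')\<close>: the element corresponding to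
  \<open>(\<delta>, 0, 0, \<delta>')\<close> under \<open>\<E>(Z \<oplus> Z', X \<oplus> X') \<cong> \<E>(Z, X) \<oplus> \<E>(Z, X') \<oplus> \<E>(Z', X) \<oplus> \<E>(Z', X')\<close>. Here \<open>p\<close>, \<open>p'\<close>
  are the projections of \<open>S = Z \<oplus> Z'\<close> and \<open>i\<close>, \<open>i'\<close> the injections of \<open>T = X \<oplus> X'\<close>.
\<close>

definition ext_sum ::
    "('o, 'm, 'e, 'z) extri_scheme \<Rightarrow> 'o \<Rightarrow> 'm \<Rightarrow> 'm \<Rightarrow> 'o \<Rightarrow> 'm \<Rightarrow> 'm \<Rightarrow> 'e \<Rightarrow> 'e \<Rightarrow> 'e" where
  "ext_sum C S p p' T i i' \<delta> \<delta>' = Emap C p i \<delta> \<oplus>\<^bsub>Ext C S T\<^esub> Emap C p' i' \<delta>'"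

locale additive_realization = additive_bifunctor +
  assumes realize_class:
      "\<lbrakk>Z \<in> Obj C; X \<in> Obj C; \<delta> \<in> carrier (Ext C Z X)\<rbrakk>
        \<Longrightarrow> realize C Z X \<delta> \<in> sequences C X Z // seq_equiv C X Z"
    and realize_morphism:
      "\<lbrakk>etriangle C X f Y g Z \<delta>; etriangle C X' f' Y' g' Z' \<delta>';
        \<alpha> \<in> Hom C X X'; \<gamma> \<in> Hom C Z Z'; push C Z \<alpha> \<delta> = pull C X' \<gamma> \<delta>'\<rbrakk>
        \<Longrightarrow> \<exists>\<beta> \<in> Hom C Y Y'. \<beta> \<cdot> f = f' \<cdot> \<alpha> \<and> g' \<cdot> \<beta> = \<gamma> \<cdot> g"
    and realize_zero:
      "is_biproduct C X Z P i j p q \<Longrightarrow> etriangle C X i P q Z \<zero>\<^bsub>Ext C Z X\<^esub>"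
    and realize_sum:
      "\<lbrakk>etriangle C X f Y g Z \<delta>; etriangle C X' f' Y' g' Z' \<delta>';
        is_biproduct C X X' SX iX iX' pX pX';
        is_biproduct C Y Y' SY iY iY' pY pY';
        is_biproduct C Z Z' SZ iZ iZ' pZ pZ'\<rbrakk>
        \<Longrightarrow> etriangle C SX (map_sum C SX pX pX' SY iY iY' f f')
                      SY (map_sum C SY pY pY' SZ iZ iZ' g g')
                      SZ (ext_sum C SZ pZ pZ' SX iX iX' \<delta> \<delta>')"


section \<open>Extriangulated categories\<close>

definition inflation :: "('o, 'm, 'e, 'z) extri_scheme \<Rightarrow> 'm \<Rightarrow> bool" where
  "inflation C f \<longleftrightarrow> (\<exists>X Y g Z \<delta>. etriangle C X f Y g Z \<delta>)"

definition deflation :: "('o, 'm, 'e, 'z) extri_scheme \<Rightarrow> 'm \<Rightarrow> bool" where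
  "deflation C g \<longleftrightarrow> (\<exists>X f Y Z \<delta>. etriangle C X f Y g Z \<delta>)"

type_synonym ('o, 'm, 'e) triangle = "'o \<times> 'm \<times> 'o \<times> 'm \<times> 'o \<times> 'e"

fun etriangle_morphism ::
    "('o, 'm, 'e, 'z) extri_scheme \<Rightarrow> ('o, 'm, 'e) triangle \<Rightarrow> ('o, 'm, 'e) triangle
      \<Rightarrow> 'm \<times> 'm \<times> 'm \<Rightarrow> bool" where
  "etriangle_morphism C (X, f, Y, g, Z, \<delta>) (X', f', Y', g', Z', \<delta>') (\<alpha>, \<beta>, \<gamma>) \<longleftrightarrow>
    etriangle C X f Y g Z \<delta> \<and> etriangle C X' f' Y' g' Z' \<delta>' \<and>
    \<alpha> \<in> Hom C X X' \<and> \<beta> \<in> Hom C Y Y' \<and> \<gamma> \<in> Hom C Z Z' \<and>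
    \<beta> \<cdot>\<^bsub>C\<^esub> f = f' \<cdot>\<^bsub>C\<^esub> \<alpha> \<and> g' \<cdot>\<^bsub>C\<^esub> \<beta> = \<gamma> \<cdot>\<^bsub>C\<^esub> g \<and>
    push C Z \<alpha> \<delta> = pull C X' \<gamma> \<delta>'"

locale extriangulated_category = additive_realization +
  assumes ET3:
      "\<lbrakk>etriangle C X f Y g Z \<delta>; etriangle C X' f' Y' g' Z' \<delta>';
        \<alpha> \<in> Hom C X X'; \<beta> \<in> Hom C Y Y'; \<beta> \<cdot> f = f' \<cdot> \<alpha>\<rbrakk>
        \<Longrightarrow> \<exists>\<gamma>. etriangle_morphism C (X, f, Y, g, Z, \<delta>) (X', f', Y', g', Z', \<delta>') (\<alpha>, \<beta>, \<gamma>)"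
    and ET3_op:
      "\<lbrakk>etriangle C X f Y g Z \<delta>; etriangle C X' f' Y' g' Z' \<delta>';
        \<beta> \<in> Hom C Y Y'; \<gamma> \<in> Hom C Z Z'; \<gamma> \<cdot> g = g' \<cdot> \<beta>\<rbrakk>
        \<Longrightarrow> \<exists>\<alpha>. etriangle_morphism C (X, f, Y, g, Z, \<delta>) (X', f', Y', g', Z', \<delta>') (\<alpha>, \<beta>, \<gamma>)"
    and ET4:
      "\<lbrakk>etriangle C A f B g D \<delta>; etriangle C B u K v E \<epsilon>\<rbrakk>
        \<Longrightarrow> \<exists>m h F \<theta> w q \<eta>. etriangle C A m K h F \<theta> \<and> etriangle C D w F q E \<eta> \<and>
              m = u \<cdot> f \<and> w \<cdot> g = h \<cdot> u \<and> v = q \<cdot> h \<and>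
              pull C A w \<theta> = \<delta> \<and> push C E g \<epsilon> = \<eta> \<and> push C F f \<theta> = pull C B q \<epsilon>"
    and ET4_op:
      "\<lbrakk>etriangle C A m K h F \<theta>; etriangle C D w F q E \<eta>\<rbrakk>
        \<Longrightarrow> \<exists>f B g \<delta> u v \<epsilon>. etriangle C A f B g D \<delta> \<and> etriangle C B u K v E \<epsilon> \<and>
              m = u \<cdot> f \<and> w \<cdot> g = h \<cdot> u \<and> v = q \<cdot> h \<and>
              pull C A w \<theta> = \<delta> \<and> push C E g \<epsilon> = \<eta> \<and> push C F f \<theta> = pull C B q \<epsilon>"

text \<open>
  The entries of \<open>row\<close> and \<open>column\<close> matrices are assembled through the projections and injections
  of a direct sum \<open>P\<close>: \<open>column\<close> is the morphism \<open>A \<rightarrow> P\<close> with components \<open>a\<close>, \<open>b\<close>, and \<open>row\<close> the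
  morphism \<open>P \<rightarrow> B\<close> with components \<open>a\<close>, \<open>b\<close>.
\<close>

definition column :: "('o, 'm, 'z) precat_scheme \<Rightarrow> 'o \<Rightarrow> 'o \<Rightarrow> 'm \<Rightarrow> 'm \<Rightarrow> 'm \<Rightarrow> 'm \<Rightarrow> 'm" where
  "column C A P i j a b = (i \<cdot>\<^bsub>C\<^esub> a) \<oplus>\<^bsub>hom_group C A P\<^esub> (j \<cdot>\<^bsub>C\<^esub> b)"

definition row :: "('o, 'm, 'z) precat_scheme \<Rightarrow> 'o \<Rightarrow> 'o \<Rightarrow> 'm \<Rightarrow> 'm \<Rightarrow> 'm \<Rightarrow> 'm \<Rightarrow> 'm" where
  "row C P B p q a b = (a \<cdot>\<^bsub>C\<^esub> p) \<oplus>\<^bsub>hom_group C P B\<^esub> (b \<cdot>\<^bsub>C\<^esub> q)"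

fun homotopic ::
    "('o, 'm, 'e, 'z) extri_scheme \<Rightarrow> ('o, 'm, 'e) triangle \<Rightarrow> ('o, 'm, 'e) triangle
      \<Rightarrow> 'm \<times> 'm \<times> 'm \<Rightarrow> bool" where
  "homotopic C (X, f, Y, g, Z, \<delta>) (X', f', Y', g', Z', \<delta>') (\<alpha>, \<beta>, \<gamma>) \<longleftrightarrow>
    etriangle_morphism C (X, f, Y, g, Z, \<delta>) (X', f', Y', g', Z', \<delta>') (\<alpha>, \<beta>, \<gamma>) \<and>
    (\<exists>s E t \<eta> \<beta>\<^sub>1 \<beta>\<^sub>2.
      etriangle C X' s E t Z \<eta> \<and>
      \<beta>\<^sub>1 \<in> Hom C Y E \<and> \<beta>\<^sub>2 \<in> Hom C E Y' \<and> \<beta> = \<beta>\<^sub>2 \<cdot>\<^bsub>C\<^esub> \<beta>\<^sub>1 \<and>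
      etriangle_morphism C (X, f, Y, g, Z, \<delta>) (X', s, E, t, Z, \<eta>) (\<alpha>, \<beta>\<^sub>1, ident C Z) \<and>
      etriangle_morphism C (X', s, E, t, Z, \<eta>) (X', f', Y', g', Z', \<delta>') (ident C X', \<beta>\<^sub>2, \<gamma>) \<and>
      (\<forall>P i j p q. is_biproduct C Y X' P i j p q \<longrightarrow>
        etriangle C X (column C X P i j f \<alpha>)
                    P (row C P E p q \<beta>\<^sub>1 (\<ominus>\<^bsub>hom_group C X' E\<^esub> s))
                    E (pull C X t \<delta>)) \<and>
      (\<forall>P i j p q. is_biproduct C Z Y' P i j p q \<longrightarrow>
        etriangle C E (column C E P i j (\<ominus>\<^bsub>hom_group C E Z\<^esub> t) \<beta>\<^sub>2)
                    P (row C P Z' p q \<gamma> g')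
                    Z' (push C Z' s \<delta>')))"

end

theory Submission
  imports Defs
begin

text \<open>
  Write the morphism as a factorization through a realization \<open>X' \<rightarrow> E \<rightarrow> Z\<close> of the extension
  \<open>\<alpha>\<^sub>* \<delta> = \<gamma>\<^sup>* \<delta>'\<close>: a map \<open>b1 : Y \<rightarrow> E\<close> over \<open>Z\<close> followed by a map \<open>b2 : E \<rightarrow> Y'\<close> under \<open>X'\<close>, each fitting
  into a square that is homotopy cartesian, that is, whose associated sequence
  \<open>X \<rightarrow> Y \<oplus> X' \<rightarrow> E\<close> (respectively \<open>E \<rightarrow> Z \<oplus> Y' \<rightarrow> Z'\<close>) is an \<open>\<E>\<close>-triangle. Such a factorization
  (\<open>homotopy_factorization\<close>) is exactly what makes \<open>(\<alpha>, b2 \<cdot> b1, \<gamma>)\<close> homotopic.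
  
  Existence. For \<open>\<alpha> : X \<rightarrow> X'\<close> the octahedral axiom ET4, applied to the split inflation
  \<open>X \<rightarrow> X \<oplus> X'\<close> with components \<open>1, \<alpha>\<close> followed by \<open>f \<oplus> 1\<close>, produces the first square
  (\<open>mapping_cone_exists\<close>); the second is its dual. Given \<open>\<alpha>\<close> and \<open>\<gamma>\<close>, the two squares are glued along
  an isomorphism between two realizations of the same extension, and this gives \<open>\<beta>'\<close>. Given \<open>\<alpha>\<close> and \<open>\<beta>\<close>,
  the first square is a weak pushout, so \<open>\<beta>\<close> factors as \<open>b2 \<cdot> b1\<close>; now \<open>f'\<close> factors as \<open>b2 \<cdot> s\<close>
  through the inflation \<open>s : X' \<rightarrow> E\<close>, and \<open>mapping_cone_of_factored_inflation\<close> finds \<open>\<gamma>'\<close> together with the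
  second square. The existence of \<open>\<alpha>'\<close> is dual.
  
  Transfer of properties. In a homotopy cartesian square inflations and deflations pass from an
  edge at the initial corner to the opposite edge (\<open>mapping_cone_inflation\<close>, \<open>mapping_cone_deflation\<close>). Hence \<open>b1\<close> inherits them
  from \<open>\<alpha>\<close> and, dually, \<open>b2\<close> from \<open>\<gamma>\<close>, which settles \<open>\<beta>' = b2 \<cdot> b1\<close>. If \<open>\<alpha>\<close> is an inflation and \<open>\<beta> = b2 \<cdot> b1\<close>
  a deflation, then \<open>b1\<close> is an inflation; an inflation can be cancelled on the right of a deflation
  (\<open>deflation_after_inflation\<close>), so \<open>b2\<close> is a deflation, and the second square passes this on to \<open>\<gamma>'\<close>.
  In the weakly idempotent complete case every left factor of a deflation is a deflation
  (\<open>wic_deflation_left_factor\<close>); this applies to \<open>\<gamma>' \<cdot> g = g' \<cdot> \<beta>\<close>, and its dual to \<open>f' \<cdot> \<alpha> = \<beta> \<cdot> f\<close>.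
  
  The axioms are self-dual, so the opposite category is again extriangulated, and each dual
  statement is obtained by interpreting the original one there.
\<close>

section \<open>Calculus of morphisms\<close>

definition mor :: "('o, 'm, 'z) precat_scheme \<Rightarrow> 'm \<Rightarrow> 'o \<Rightarrow> 'o \<Rightarrow> bool"
    ("\<guillemotleft>_ : _ \<rightarrow>\<index> _\<guillemotright>") where
  "\<guillemotleft>f : X \<rightarrow>\<^bsub>C\<^esub> Y\<guillemotright> \<longleftrightarrow> X \<in> Obj C \<and> Y \<in> Obj C \<and> f \<in> Hom C X Y"

definition arr :: "('o, 'm, 'z) precat_scheme \<Rightarrow> 'm \<Rightarrow> bool" where
  "arr C f \<longleftrightarrow> (\<exists>X Y. \<guillemotleft>f : X \<rightarrow>\<^bsub>C\<^esub> Y\<guillemotright>)"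

text \<open>
  With a source and a target function, the side conditions of the category axioms become
  equations between objects, without intermediate objects to be guessed. The laws of the calculus
  become conditional rewrite rules whose conditions the simplifier can discharge.
\<close>

definition src :: "('o, 'm, 'z) precat_scheme \<Rightarrow> 'm \<Rightarrow> 'o" where
  "src C f = (SOME X. \<exists>Y. \<guillemotleft>f : X \<rightarrow>\<^bsub>C\<^esub> Y\<guillemotright>)"

definition tgt :: "('o, 'm, 'z) precat_scheme \<Rightarrow> 'm \<Rightarrow> 'o" where
  "tgt C f = (SOME Y. \<exists>X. \<guillemotleft>f : X \<rightarrow>\<^bsub>C\<^esub> Y\<guillemotright>)"

text \<open>
  Addition and negation read off the Hom group from the (first) argument, so that terms
  need not carry it.
\<close>

definition madd :: "('o, 'm, 'z) precat_scheme \<Rightarrow> 'm \<Rightarrow> 'm \<Rightarrow> 'm" (infixl "\<boxplus>\<index>" 65) where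
  "f \<boxplus>\<^bsub>C\<^esub> g = f \<oplus>\<^bsub>hom_group C (src C f) (tgt C f)\<^esub> g"

definition mneg :: "('o, 'm, 'z) precat_scheme \<Rightarrow> 'm \<Rightarrow> 'm" ("\<boxminus>\<index> _" [81] 80) where
  "\<boxminus>\<^bsub>C\<^esub> f = \<ominus>\<^bsub>hom_group C (src C f) (tgt C f)\<^esub> f"

abbreviation zmor :: "('o, 'm, 'z) precat_scheme \<Rightarrow> 'o \<Rightarrow> 'o \<Rightarrow> 'm" where
  "zmor C X Y \<equiv> \<zero>\<^bsub>hom_group C X Y\<^esub>"

context category
begin

lemma mor_unique: "\<guillemotleft>f : X \<rightarrow> Y\<guillemotright> \<Longrightarrow> \<guillemotleft>f : X' \<rightarrow> Y'\<guillemotright> \<Longrightarrow> X = X' \<and> Y = Y'"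
  using Hom_disjoint unfolding mor_def by metis

lemma mor_iff: "\<guillemotleft>f : X \<rightarrow> Y\<guillemotright> \<longleftrightarrow> arr C f \<and> src C f = X \<and> tgt C f = Y"
proof
  assume *: "\<guillemotleft>f : X \<rightarrow> Y\<guillemotright>"
  have "src C f = X"
    unfolding src_def by (rule some_equality) (use * mor_unique in blast)+
  moreover have "tgt C f = Y"
    unfolding tgt_def by (rule some_equality) (use * mor_unique in blast)+
  ultimately show "arr C f \<and> src C f = X \<and> tgt C f = Y"
    using * unfolding arr_def by blast
next
  assume *: "arr C f \<and> src C f = X \<and> tgt C f = Y"
  then obtain X' Y' where f: "\<guillemotleft>f : X' \<rightarrow> Y'\<guillemotright>" unfolding arr_def by blast
  have "src C f = X'"
    unfolding src_def by (rule some_equality) (use f mor_unique in blast)+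
  moreover have "tgt C f = Y'"
    unfolding tgt_def by (rule some_equality) (use f mor_unique in blast)+
  ultimately show "\<guillemotleft>f : X \<rightarrow> Y\<guillemotright>" using f * by simp
qed

lemma Hom_iff:
  "X \<in> Obj C \<Longrightarrow> Y \<in> Obj C \<Longrightarrow> f \<in> Hom C X Y \<longleftrightarrow> arr C f \<and> src C f = X \<and> tgt C f = Y"
  using mor_iff[of f X Y] unfolding mor_def by simp

lemma morD: "\<guillemotleft>f : X \<rightarrow> Y\<guillemotright> \<Longrightarrow> arr C f" "\<guillemotleft>f : X \<rightarrow> Y\<guillemotright> \<Longrightarrow> src C f = X" "\<guillemotleft>f : X \<rightarrow> Y\<guillemotright> \<Longrightarrow> tgt C f = Y"
    "\<guillemotleft>f : X \<rightarrow> Y\<guillemotright> \<Longrightarrow> X \<in> Obj C" "\<guillemotleft>f : X \<rightarrow> Y\<guillemotright> \<Longrightarrow> Y \<in> Obj C"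
  using mor_iff[of f X Y] unfolding mor_def by auto

lemma arrE: "arr C f \<Longrightarrow> \<guillemotleft>f : src C f \<rightarrow> tgt C f\<guillemotright>"
  using mor_iff by blast

lemma arr_Obj [simp]: "arr C f \<Longrightarrow> src C f \<in> Obj C" "arr C f \<Longrightarrow> tgt C f \<in> Obj C"
  using arrE unfolding mor_def by blast+

lemma arr_Hom: "arr C f \<Longrightarrow> f \<in> Hom C (src C f) (tgt C f)"
  using arrE unfolding mor_def by blast

lemma ident_mor: "X \<in> Obj C \<Longrightarrow> \<guillemotleft>ident C X : X \<rightarrow> X\<guillemotright>"
  using ident_closed unfolding mor_def by blast

lemma ident_simps [simp]:
  "X \<in> Obj C \<Longrightarrow> arr C (ident C X)" "X \<in> Obj C \<Longrightarrow> src C (ident C X) = X"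
  "X \<in> Obj C \<Longrightarrow> tgt C (ident C X) = X"
  using ident_mor morD by metis+

lemma comp_mor:
  "arr C f \<Longrightarrow> arr C g \<Longrightarrow> src C g = tgt C f \<Longrightarrow> \<guillemotleft>g \<cdot> f : src C f \<rightarrow> tgt C g\<guillemotright>"
  using comp_closed[of "src C f" "tgt C f" "tgt C g" f g] arr_Hom[of f] arr_Hom[of g]
  unfolding mor_def by simp

lemma comp_simps [simp]:
  assumes "arr C f" "arr C g" "src C g = tgt C f"
  shows "arr C (g \<cdot> f)" "src C (g \<cdot> f) = src C f" "tgt C (g \<cdot> f) = tgt C g"
  using comp_mor[OF assms] morD by blast+

lemma ident_comp [simp]:
  "arr C f \<Longrightarrow> src C f = X \<Longrightarrow> f \<cdot> ident C X = f"
  "arr C f \<Longrightarrow> tgt C f = X \<Longrightarrow> ident C X \<cdot> f = f"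
  using comp_ident_right comp_ident_left arr_Hom arr_Obj by metis+

lemma assoc [simp]:
  "arr C f \<Longrightarrow> arr C g \<Longrightarrow> arr C h \<Longrightarrow> src C g = tgt C f \<Longrightarrow> src C h = tgt C g
    \<Longrightarrow> (h \<cdot> g) \<cdot> f = h \<cdot> (g \<cdot> f)"
  by (rule comp_assoc[of "src C f" "tgt C f" "tgt C g" "tgt C h"])
    (use arr_Hom[of f] arr_Hom[of g] arr_Hom[of h] in auto)

text \<open>
  Composites are normalised to associate to the right, so a known value of \<open>g \<cdot> f\<close> has to be
  available also in front of a further factor.
\<close>

lemma reassoc:
  "g \<cdot> f = e \<Longrightarrow> arr C f \<Longrightarrow> arr C g \<Longrightarrow> src C g = tgt C f \<Longrightarrow> arr C x \<Longrightarrow> src C f = tgt C x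
    \<Longrightarrow> g \<cdot> (f \<cdot> x) = e \<cdot> x"
  using assoc[of x f g] by metis

end

context preadditive_category
begin

lemma hom_group_arr: "arr C f \<Longrightarrow> abelian_group (hom_group C (src C f) (tgt C f))"
  by (simp add: hom_abelian_group)

lemma zmor_simps [simp]:
  assumes "X \<in> Obj C" "Y \<in> Obj C"
  shows "arr C (zmor C X Y)" "src C (zmor C X Y) = X" "tgt C (zmor C X Y) = Y"
proof -
  interpret G: abelian_group "hom_group C X Y" using assms by (rule hom_abelian_group)
  show "arr C (zmor C X Y)" "src C (zmor C X Y) = X" "tgt C (zmor C X Y) = Y"
    using Hom_iff[OF assms, of "zmor C X Y"] G.zero_closed by auto
qed

lemma madd_conv: "arr C f \<Longrightarrow> src C f = X \<Longrightarrow> tgt C f = Y \<Longrightarrow> f \<oplus>\<^bsub>hom_group C X Y\<^esub> g = f \<boxplus> g"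
  by (simp add: madd_def)

lemma mneg_conv: "arr C f \<Longrightarrow> src C f = X \<Longrightarrow> tgt C f = Y \<Longrightarrow> \<ominus>\<^bsub>hom_group C X Y\<^esub> f = \<boxminus> f"
  by (simp add: mneg_def)

lemma madd_mor:
  assumes "arr C f" "arr C g" "src C g = src C f" "tgt C g = tgt C f"
  shows "\<guillemotleft>f \<boxplus> g : src C f \<rightarrow> tgt C f\<guillemotright>"
proof -
  interpret G: abelian_group "hom_group C (src C f) (tgt C f)" using assms(1) by (rule hom_group_arr)
  show ?thesis using assms G.a_closed[of f g] arr_Hom[of f] arr_Hom[of g]
    unfolding mor_def madd_def by auto
qed

lemma madd_simps [simp]:
  assumes "arr C f" "arr C g" "src C g = src C f" "tgt C g = tgt C f"
  shows "arr C (f \<boxplus> g)" "src C (f \<boxplus> g) = src C f" "tgt C (f \<boxplus> g) = tgt C f"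
  using madd_mor[OF assms] morD by blast+

lemma mneg_mor: "arr C f \<Longrightarrow> \<guillemotleft>\<boxminus> f : src C f \<rightarrow> tgt C f\<guillemotright>"
proof -
  assume f: "arr C f"
  interpret G: abelian_group "hom_group C (src C f) (tgt C f)" using f by (rule hom_group_arr)
  show ?thesis using f G.a_inv_closed[of f] arr_Hom[of f]
    unfolding mor_def mneg_def by auto
qed

lemma mneg_simps [simp]:
  assumes "arr C f"
  shows "arr C (\<boxminus> f)" "src C (\<boxminus> f) = src C f" "tgt C (\<boxminus> f) = tgt C f"
  using mneg_mor[OF assms] morD by blast+

lemma madd_comm:
  assumes "arr C f" "arr C g" "src C g = src C f" "tgt C g = tgt C f"
  shows "f \<boxplus> g = g \<boxplus> f"
proof -
  interpret G: abelian_group "hom_group C (src C f) (tgt C f)" using assms(1) by (rule hom_group_arr)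
  show ?thesis using assms G.a_comm[of f g] arr_Hom[of f] arr_Hom[of g] by (simp add: madd_def)
qed

lemma madd_assoc [simp]:
  assumes "arr C f" "arr C g" "arr C h" "src C g = src C f" "tgt C g = tgt C f"
    "src C h = src C f" "tgt C h = tgt C f"
  shows "(f \<boxplus> g) \<boxplus> h = f \<boxplus> (g \<boxplus> h)"
proof -
  interpret G: abelian_group "hom_group C (src C f) (tgt C f)" using assms(1) by (rule hom_group_arr)
  have "src C (f \<oplus>\<^bsub>hom_group C (src C f) (tgt C f)\<^esub> g) = src C f"
    "tgt C (f \<oplus>\<^bsub>hom_group C (src C f) (tgt C f)\<^esub> g) = tgt C f"
    using madd_simps[of f g] assms by (simp_all add: madd_def)
  then show ?thesis using assms G.a_assoc[of f g h] arr_Hom[of f] arr_Hom[of g] arr_Hom[of h]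
    by (simp add: madd_def)
qed

lemma madd_lcomm:
  assumes "arr C f" "arr C g" "arr C h" "src C g = src C f" "tgt C g = tgt C f"
    "src C h = src C f" "tgt C h = tgt C f"
  shows "f \<boxplus> (g \<boxplus> h) = g \<boxplus> (f \<boxplus> h)"
  using madd_assoc[of f g h] madd_assoc[of g f h] madd_comm[of f g] assms by simp

lemmas madd_ac = madd_comm madd_lcomm

lemma madd_zero [simp]:
  assumes "arr C f" "src C f = X" "tgt C f = Y"
  shows "f \<boxplus> zmor C X Y = f" "zmor C X Y \<boxplus> f = f"
proof -
  interpret G: abelian_group "hom_group C (src C f) (tgt C f)" using assms(1) by (rule hom_group_arr)
  show "f \<boxplus> zmor C X Y = f" using assms arr_Hom[of f] by (auto simp: madd_def)
  then show "zmor C X Y \<boxplus> f = f" using madd_comm[of f "zmor C X Y"] assms by auto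
qed

lemma madd_mneg [simp]:
  assumes "arr C f"
  shows "f \<boxplus> \<boxminus> f = zmor C (src C f) (tgt C f)" "\<boxminus> f \<boxplus> f = zmor C (src C f) (tgt C f)"
proof -
  interpret G: abelian_group "hom_group C (src C f) (tgt C f)" using assms(1) by (rule hom_group_arr)
  show 1: "f \<boxplus> \<boxminus> f = zmor C (src C f) (tgt C f)"
    using G.r_neg[of f] arr_Hom[of f] assms by (auto simp: madd_def mneg_def)
  then show "\<boxminus> f \<boxplus> f = zmor C (src C f) (tgt C f)"
    using madd_comm[of f "\<boxminus> f"] assms by simp
qed

lemma madd_mneg_cancel [simp]:
  assumes "arr C f" "arr C g" "src C g = src C f" "tgt C g = tgt C f"
  shows "f \<boxplus> (\<boxminus> f \<boxplus> g) = g" "\<boxminus> f \<boxplus> (f \<boxplus> g) = g"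
  using madd_assoc[of f "\<boxminus> f" g] madd_assoc[of "\<boxminus> f" f g] assms by simp_all

lemma madd_left_cancel:
  assumes "f \<boxplus> g = f \<boxplus> h" "arr C f" "arr C g" "arr C h" "src C g = src C f" "tgt C g = tgt C f"
    "src C h = src C f" "tgt C h = tgt C f"
  shows "g = h"
proof -
  have "g = \<boxminus> f \<boxplus> (f \<boxplus> g)" using assms(2-) by simp
  also have "\<dots> = \<boxminus> f \<boxplus> (f \<boxplus> h)" unfolding assms(1) ..
  also have "\<dots> = h" using assms(2-) by simp
  finally show ?thesis .
qed

lemma mneg_unique:
  assumes "f \<boxplus> g = zmor C (src C f) (tgt C f)" "arr C f" "arr C g" "src C g = src C f" "tgt C g = tgt C f"
  shows "g = \<boxminus> f"
  using madd_left_cancel[of f g "\<boxminus> f"] assms by simp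

lemma mneg_mneg [simp]: "arr C f \<Longrightarrow> \<boxminus> (\<boxminus> f) = f"
  by (rule mneg_unique[symmetric]) simp_all

lemma mneg_zmor [simp]: "X \<in> Obj C \<Longrightarrow> Y \<in> Obj C \<Longrightarrow> \<boxminus> zmor C X Y = zmor C X Y"
  by (rule mneg_unique[symmetric]) simp_all

lemma mneg_madd [simp]:
  assumes "arr C f" "arr C g" "src C g = src C f" "tgt C g = tgt C f"
  shows "\<boxminus> (f \<boxplus> g) = \<boxminus> f \<boxplus> \<boxminus> g"
  by (rule mneg_unique[symmetric]) (use assms in \<open>simp_all add: madd_lcomm[of g "\<boxminus> f" "\<boxminus> g"]\<close>)

lemma comp_madd [simp]:
  assumes "arr C f" "arr C f'" "src C f' = src C f" "tgt C f' = tgt C f" "arr C g" "src C g = tgt C f"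
  shows "g \<cdot> (f \<boxplus> f') = g \<cdot> f \<boxplus> g \<cdot> f'"
  using comp_add_right[of "src C f" "tgt C f" "tgt C g" f f' g]
    arr_Hom[of f] arr_Hom[of f'] arr_Hom[of g] assms by (simp add: madd_conv)

lemma madd_comp [simp]:
  assumes "arr C f" "arr C g" "arr C g'" "src C g' = src C g" "tgt C g' = tgt C g" "src C g = tgt C f"
  shows "(g \<boxplus> g') \<cdot> f = g \<cdot> f \<boxplus> g' \<cdot> f"
  using comp_add_left[of "src C f" "tgt C f" "tgt C g" f g g']
    arr_Hom[of f] arr_Hom[of g] arr_Hom[of g'] assms by (simp add: madd_conv)

lemma madd_self_zero:
  assumes "f \<boxplus> f = f" "arr C f" shows "f = zmor C (src C f) (tgt C f)"
  using madd_left_cancel[of f f "zmor C (src C f) (tgt C f)"] assms by simp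

lemma comp_zmor [simp]:
  "arr C g \<Longrightarrow> src C g = Y \<Longrightarrow> X \<in> Obj C \<Longrightarrow> g \<cdot> zmor C X Y = zmor C X (tgt C g)"
proof -
  assume *: "arr C g" "src C g = Y" "X \<in> Obj C"
  have [simp]: "Y \<in> Obj C" using * arr_Obj by blast
  have "g \<cdot> zmor C X Y \<boxplus> g \<cdot> zmor C X Y = g \<cdot> zmor C X Y"
    using * by (simp add: comp_madd[symmetric] del: comp_madd)
  from madd_self_zero[OF this] * show ?thesis by simp
qed

lemma zmor_comp [simp]:
  "arr C f \<Longrightarrow> tgt C f = Y \<Longrightarrow> Z \<in> Obj C \<Longrightarrow> zmor C Y Z \<cdot> f = zmor C (src C f) Z"
proof -
  assume *: "arr C f" "tgt C f = Y" "Z \<in> Obj C"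
  have [simp]: "Y \<in> Obj C" using * arr_Obj by blast
  have "zmor C Y Z \<cdot> f \<boxplus> zmor C Y Z \<cdot> f = zmor C Y Z \<cdot> f"
    using * by (simp add: madd_comp[symmetric] del: madd_comp)
  from madd_self_zero[OF this] * show ?thesis by simp
qed

lemma comp_mneg [simp]:
  "arr C f \<Longrightarrow> arr C g \<Longrightarrow> src C g = tgt C f \<Longrightarrow> g \<cdot> \<boxminus> f = \<boxminus> (g \<cdot> f)"
  by (rule mneg_unique) (simp_all add: comp_madd[symmetric] del: comp_madd)

lemma mneg_comp [simp]:
  "arr C f \<Longrightarrow> arr C g \<Longrightarrow> src C g = tgt C f \<Longrightarrow> \<boxminus> g \<cdot> f = \<boxminus> (g \<cdot> f)"
  by (rule mneg_unique) (simp_all add: madd_comp[symmetric] del: madd_comp)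

lemma eq_if_diff_zero:
  assumes "f \<boxplus> \<boxminus> g = zmor C (src C f) (tgt C f)"
    "arr C f" "arr C g" "src C g = src C f" "tgt C g = tgt C f"
  shows "f = g"
proof -
  have "\<boxminus> g = \<boxminus> f" by (rule mneg_unique) (use assms in simp_all)
  then have "\<boxminus> (\<boxminus> g) = \<boxminus> (\<boxminus> f)" by (rule arg_cong)
  then show ?thesis using assms by simp
qed

end

section \<open>Direct sums\<close>

context preadditive_category
begin

lemma biproductD:
  assumes "is_biproduct C A B P i j p q"
  shows "A \<in> Obj C" "B \<in> Obj C" "P \<in> Obj C"
    "arr C i" "src C i = A" "tgt C i = P" "arr C j" "src C j = B" "tgt C j = P"
    "arr C p" "src C p = P" "tgt C p = A" "arr C q" "src C q = P" "tgt C q = B"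
    "p \<cdot> i = ident C A" "q \<cdot> j = ident C B" "q \<cdot> i = zmor C A B" "p \<cdot> j = zmor C B A"
    "i \<cdot> p \<boxplus> j \<cdot> q = ident C P"
    "\<And>x. arr C x \<Longrightarrow> tgt C x = A \<Longrightarrow> p \<cdot> (i \<cdot> x) = x"
    "\<And>x. arr C x \<Longrightarrow> tgt C x = B \<Longrightarrow> q \<cdot> (j \<cdot> x) = x"
    "\<And>x. arr C x \<Longrightarrow> tgt C x = A \<Longrightarrow> q \<cdot> (i \<cdot> x) = zmor C (src C x) B"
    "\<And>x. arr C x \<Longrightarrow> tgt C x = B \<Longrightarrow> p \<cdot> (j \<cdot> x) = zmor C (src C x) A"
proof -
  show o [simp]: "A \<in> Obj C" "B \<in> Obj C" "P \<in> Obj C"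
    using assms unfolding is_biproduct_def by auto
  show m [simp]: "arr C i" "src C i = A" "tgt C i = P" "arr C j" "src C j = B" "tgt C j = P"
    "arr C p" "src C p = P" "tgt C p = A" "arr C q" "src C q = P" "tgt C q = B"
    using assms unfolding is_biproduct_def by (auto simp: Hom_iff)
  show e: "p \<cdot> i = ident C A" "q \<cdot> j = ident C B" "q \<cdot> i = zmor C A B" "p \<cdot> j = zmor C B A"
    using assms unfolding is_biproduct_def by auto
  show "i \<cdot> p \<boxplus> j \<cdot> q = ident C P"
    using assms madd_conv[of "i \<cdot> p" P P "j \<cdot> q"] unfolding is_biproduct_def by simp
  fix x assume x: "arr C x"
  show "tgt C x = A \<Longrightarrow> p \<cdot> (i \<cdot> x) = x" "tgt C x = B \<Longrightarrow> q \<cdot> (j \<cdot> x) = x"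
    "tgt C x = A \<Longrightarrow> q \<cdot> (i \<cdot> x) = zmor C (src C x) B"
    "tgt C x = B \<Longrightarrow> p \<cdot> (j \<cdot> x) = zmor C (src C x) A"
    using x e by (simp_all add: assoc[symmetric] del: assoc)
qed

lemma biproductI:
  assumes "A \<in> Obj C" "B \<in> Obj C" "P \<in> Obj C"
    "arr C i" "src C i = A" "tgt C i = P" "arr C j" "src C j = B" "tgt C j = P"
    "arr C p" "src C p = P" "tgt C p = A" "arr C q" "src C q = P" "tgt C q = B"
    "p \<cdot> i = ident C A" "q \<cdot> j = ident C B" "q \<cdot> i = zmor C A B" "p \<cdot> j = zmor C B A"
    "i \<cdot> p \<boxplus> j \<cdot> q = ident C P"
  shows "is_biproduct C A B P i j p q"
  using assms unfolding is_biproduct_def by (simp add: Hom_iff madd_conv)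

lemma biproduct_swap:
  assumes "is_biproduct C A B P i j p q"
  shows "is_biproduct C B A P j i q p"
proof -
  note [simp] = biproductD[OF assms]
  show ?thesis using biproductD(20)[OF assms] by (intro biproductI) (simp_all add: madd_comm)
qed

text \<open>
  The automorphism \<open>(1, 0; f, 1)\<close> of \<open>A \<oplus> B\<close> turns one direct sum decomposition into another. It yields
  the split sequence \<open>A \<rightarrow> A \<oplus> B \<rightarrow> B\<close> with maps \<open>(1, f)\<close> and \<open>(-f, 1)\<close>.
\<close>

lemma biproduct_shear:
  assumes "is_biproduct C A B P i j p q" "arr C f" "src C f = A" "tgt C f = B"
  shows "is_biproduct C A B P (i \<boxplus> j \<cdot> f) j p (q \<boxplus> \<boxminus> (f \<cdot> p))"
proof -
  note [simp] = biproductD[OF assms(1)] assms(2-4)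
  have "i \<cdot> p \<boxplus> (j \<cdot> (f \<cdot> p) \<boxplus> (j \<cdot> q \<boxplus> \<boxminus> (j \<cdot> (f \<cdot> p)))) = ident C P"
    using madd_lcomm[of "j \<cdot> (f \<cdot> p)" "j \<cdot> q" "\<boxminus> (j \<cdot> (f \<cdot> p))"] by simp
  then show ?thesis by (intro biproductI) simp_all
qed

lemma biproduct_zero_left:
  assumes "is_zero_object C N" "B \<in> Obj C"
  shows "is_biproduct C N B B (zmor C N B) (ident C B) (zmor C B N) (ident C B)"
proof -
  have [simp]: "N \<in> Obj C" using assms unfolding is_zero_object_def by blast
  have "ident C N = zmor C N N"
    using assms Hom_iff[of N N] unfolding is_zero_object_def
    by (metis \<open>N \<in> Obj C\<close> ident_simps zmor_simps)
  then show ?thesis using assms(2) by (intro biproductI) simp_all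
qed

lemma into_biproduct_eqI:
  assumes "is_biproduct C A B P i j p q" "arr C u" "arr C v" "tgt C u = P" "tgt C v = P"
    "src C u = src C v" "p \<cdot> u = p \<cdot> v" "q \<cdot> u = q \<cdot> v"
  shows "u = v"
proof -
  note [simp] = biproductD[OF assms(1)] assms(2-6)
  have "u = (i \<cdot> p \<boxplus> j \<cdot> q) \<cdot> u" by simp
  also have "\<dots> = i \<cdot> (p \<cdot> u) \<boxplus> j \<cdot> (q \<cdot> u)" by (simp del: biproductD(20)[OF assms(1)])
  also have "\<dots> = i \<cdot> (p \<cdot> v) \<boxplus> j \<cdot> (q \<cdot> v)" using assms by simp
  also have "\<dots> = (i \<cdot> p \<boxplus> j \<cdot> q) \<cdot> v" by (simp del: biproductD(20)[OF assms(1)])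
  also have "\<dots> = v" by simp
  finally show ?thesis .
qed

lemma out_of_biproduct_decomp:
  assumes "is_biproduct C A B P i j p q" "arr C u" "src C u = P"
  shows "u = (u \<cdot> i) \<cdot> p \<boxplus> (u \<cdot> j) \<cdot> q"
proof -
  note [simp] = biproductD[OF assms(1)] assms(2-3)
  have "u = u \<cdot> (i \<cdot> p \<boxplus> j \<cdot> q)" by simp
  also have "\<dots> = (u \<cdot> i) \<cdot> p \<boxplus> (u \<cdot> j) \<cdot> q" by (simp del: biproductD(20)[OF assms(1)])
  finally show ?thesis .
qed

lemma column_conv:
  assumes "is_biproduct C A B P i j p q" "arr C a" "src C a = X" "tgt C a = A"
  shows "column C X P i j a b = i \<cdot> a \<boxplus> j \<cdot> b"
  unfolding column_def using biproductD[OF assms(1)] assms(2-) by (simp add: madd_conv)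

lemma row_conv:
  assumes "is_biproduct C A B P i j p q" "arr C a" "src C a = A" "tgt C a = Y"
  shows "row C P Y p q a b = a \<cdot> p \<boxplus> b \<cdot> q"
  unfolding row_def using biproductD[OF assms(1)] assms(2-) by (simp add: madd_conv)

lemma biproduct_cokernel:
  assumes "is_biproduct C A B P i j p q"
  shows "is_cokernel C A P i B q"
proof -
  note [simp] = biproductD[OF assms]
  have "\<exists>!k. k \<in> Hom C B D \<and> k \<cdot> q = h" if "D \<in> Obj C" "h \<in> Hom C P D" "h \<cdot> i = zmor C A D" for D h
  proof -
    have [simp]: "D \<in> Obj C" "arr C h" "src C h = P" "tgt C h = D" using that by (simp_all add: Hom_iff)
    have "h = (h \<cdot> j) \<cdot> q"
      using out_of_biproduct_decomp[OF assms, of h] that(3) by simp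
    moreover have "k = h \<cdot> j" if "arr C k" "src C k = B" "tgt C k = D" "k \<cdot> q = h" for k
      using that(1-3) unfolding that(4)[symmetric] by simp
    ultimately show ?thesis by (intro ex1I[of _ "h \<cdot> j"]) (auto simp: Hom_iff)
  qed
  moreover have "B \<in> Obj C" "q \<in> Hom C P B" "q \<cdot> i = zmor C A B" by (simp_all add: Hom_iff)
  ultimately show ?thesis unfolding is_cokernel_def by blast
qed

text \<open>
  The cokernel \<open>c\<close> of a section \<open>s\<close> with retraction \<open>r\<close> is itself split, because \<open>1 - s r\<close> kills \<open>s\<close>
  and hence factors as \<open>k \<cdot> c\<close>. The resulting decomposition is self-dual, which is how weak
  idempotent completeness passes to the opposite category.
\<close>

lemma weakly_idempotent_complete_biproduct:
  assumes "weakly_idempotent_complete C" "arr C s" "src C s = A" "tgt C s = B"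
    "arr C r" "src C r = B" "tgt C r = A" "r \<cdot> s = ident C A"
  shows "\<exists>Q k c. is_biproduct C A Q B s k r c"
proof -
  note [simp] = assms(2-8)
  have [simp]: "A \<in> Obj C" "B \<in> Obj C" using arr_Obj[of s] by simp_all
  have "r \<in> Hom C B A" "s \<in> Hom C A B" by (simp_all add: Hom_iff)
  then have sec: "is_section C A B s" unfolding is_section_def using assms(8) by blast
  then obtain Q c where c: "is_cokernel C A B s Q c"
    using assms(1) unfolding weakly_idempotent_complete_def by (meson \<open>A \<in> Obj C\<close> \<open>B \<in> Obj C\<close>)
  then have [simp]: "Q \<in> Obj C" "arr C c" "src C c = B" "tgt C c = Q" and cs [simp]: "c \<cdot> s = zmor C A Q"
    unfolding is_cokernel_def by (auto simp: Hom_iff)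
  have un: "\<exists>!k. k \<in> Hom C Q D \<and> k \<cdot> c = h" if "D \<in> Obj C" "h \<in> Hom C B D" "h \<cdot> s = zmor C A D" for D h
    using c that unfolding is_cokernel_def by blast
  have epi: "x = y" if "arr C x" "arr C y" "src C x = Q" "src C y = Q" "tgt C x = tgt C y" "x \<cdot> c = y \<cdot> c" for x y
  proof -
    have [simp]: "tgt C y \<in> Obj C" using that by simp
    have "\<exists>!k. k \<in> Hom C Q (tgt C y) \<and> k \<cdot> c = y \<cdot> c"
      by (rule un) (use that in \<open>simp_all add: Hom_iff\<close>)
    moreover have "x \<in> Hom C Q (tgt C y)" "y \<in> Hom C Q (tgt C y)"
      using that by (simp_all add: Hom_iff)
    ultimately show ?thesis using that(6) by blast
  qed
  have "\<exists>!k. k \<in> Hom C Q B \<and> k \<cdot> c = ident C B \<boxplus> \<boxminus> (s \<cdot> r)"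
    by (rule un) (simp_all add: Hom_iff)
  then obtain k where k': "k \<in> Hom C Q B" and kc: "k \<cdot> c = ident C B \<boxplus> \<boxminus> (s \<cdot> r)" by blast
  have [simp]: "arr C k" "src C k = Q" "tgt C k = B" using k' by (simp_all add: Hom_iff)
  have "r \<cdot> (k \<cdot> c) = zmor C B A" unfolding kc by (simp add: reassoc[OF assms(8)])
  then have rk: "r \<cdot> k = zmor C Q A" using epi[of "r \<cdot> k" "zmor C Q A"] by simp
  have "c \<cdot> (k \<cdot> c) = c" unfolding kc by (simp add: reassoc[OF cs])
  then have ck: "c \<cdot> k = ident C Q" using epi[of "c \<cdot> k" "ident C Q"] by simp
  have "is_biproduct C A Q B s k r c"
    by (rule biproductI) (simp_all add: rk ck kc madd_lcomm[of "s \<cdot> r"])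
  then show ?thesis by blast
qed

end

section \<open>The opposite category\<close>

text \<open>
  The record type is kept, so that \<open>opp\<close> is an involution and a statement about \<open>opp C\<close> can be
  dualised back to \<open>C\<close>.
\<close>

definition opp :: "('o, 'm, 'e, 'z) extri_scheme \<Rightarrow> ('o, 'm, 'e, 'z) extri_scheme" where
  "opp C = C\<lparr>hom_group := \<lambda>X Y. hom_group C Y X, mcomp := \<lambda>g f. f \<cdot>\<^bsub>C\<^esub> g,
     Ext := \<lambda>Z X. Ext C X Z, Emap := \<lambda>g f. Emap C f g,
     realize := \<lambda>Z X \<delta>. (\<lambda>(f, Y, g). (g, Y, f)) ` realize C X Z \<delta>\<rparr>"

lemma opp_simps [simp]:
  "Obj (opp C) = Obj C" "hom_group (opp C) X Y = hom_group C Y X"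
  "g \<cdot>\<^bsub>opp C\<^esub> f = f \<cdot>\<^bsub>C\<^esub> g" "ident (opp C) = ident C" "Ext (opp C) Z X = Ext C X Z"
  "Emap (opp C) g f = Emap C f g"
  "push (opp C) Z f = pull C Z f" "pull (opp C) Z f = push C Z f"
  by (simp_all add: opp_def push_def pull_def fun_eq_iff)

lemma opp_mor [simp]: "\<guillemotleft>f : X \<rightarrow>\<^bsub>opp C\<^esub> Y\<guillemotright> \<longleftrightarrow> \<guillemotleft>f : Y \<rightarrow>\<^bsub>C\<^esub> X\<guillemotright>"
  by (auto simp: mor_def)

lemma opp_arr [simp]: "arr (opp C) f \<longleftrightarrow> arr C f" "src (opp C) f = tgt C f" "tgt (opp C) f = src C f"
  by (auto simp: arr_def src_def tgt_def)

lemma opp_madd [simp]: "f \<boxplus>\<^bsub>opp C\<^esub> g = f \<boxplus>\<^bsub>C\<^esub> g" "\<boxminus>\<^bsub>opp C\<^esub> f = \<boxminus>\<^bsub>C\<^esub> f"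
  by (simp_all add: madd_def mneg_def)

lemma opp_biproduct [simp]: "is_biproduct (opp C) A B P i j p q \<longleftrightarrow> is_biproduct C A B P p q i j"
  by (auto simp: is_biproduct_def)

lemma opp_row_column [simp]:
  "column (opp C) A P i j a b = row C P A i j a b" "row (opp C) P B p q a b = column C B P p q a b"
  by (simp_all add: row_def column_def)

lemma opp_zero_object [simp]: "is_zero_object (opp C) N \<longleftrightarrow> is_zero_object C N"
  by (auto simp: is_zero_object_def)

lemma swap_image [simp]: "(a, b, c) \<in> (\<lambda>(f, Y, g). (g, Y, f)) ` S \<longleftrightarrow> (c, b, a) \<in> S"
  by force

lemma opp_realize [simp]: "(f, Y, g) \<in> realize (opp C) Z X \<delta> \<longleftrightarrow> (g, Y, f) \<in> realize C X Z \<delta>"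
  by (simp add: opp_def)

lemma opp_etriangle [simp]: "etriangle (opp C) X f Y g Z \<delta> \<longleftrightarrow> etriangle C Z g Y f X \<delta>"
  by (auto simp: etriangle_def)

lemma opp_inflation [simp]: "inflation (opp C) f \<longleftrightarrow> deflation C f" "deflation (opp C) f \<longleftrightarrow> inflation C f"
  unfolding inflation_def deflation_def opp_etriangle by blast+

lemma opp_etriangle_morphism [simp]:
  "etriangle_morphism (opp C) (X, f, Y, g, Z, \<delta>) (X', f', Y', g', Z', \<delta>') (\<alpha>, \<beta>, \<gamma>) \<longleftrightarrow>
    etriangle_morphism C (Z', g', Y', f', X', \<delta>') (Z, g, Y, f, X, \<delta>) (\<gamma>, \<beta>, \<alpha>)"
  by auto

lemma opp_is_iso [simp]: "is_iso (opp C) X Y h \<longleftrightarrow> is_iso C Y X h"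
  by (auto simp: is_iso_def)

lemma (in additive_bifunctor) opp_additive_bifunctor: "additive_bifunctor (opp C)"
proof (intro additive_bifunctor.intro additive_bifunctor_axioms.intro additive_category.intro
    additive_category_axioms.intro preadditive_category.intro preadditive_category_axioms.intro
    category.intro, goal_cases)
  case 1 then show ?case using Hom_disjoint by auto
next
  case 2 then show ?case by (simp add: ident_closed)
next
  case 3 then show ?case by (simp add: Hom_iff)
next
  case 4 then show ?case by (simp add: Hom_iff)
next
  case 5 then show ?case by (simp add: Hom_iff)
next
  case 6 then show ?case by (simp add: Hom_iff)
next
  case 7 then show ?case by (simp add: hom_abelian_group)
next
  case 8 then show ?case by (simp add: Hom_iff madd_conv)
next
  case 9 then show ?case by (simp add: Hom_iff madd_conv)
next
  case 10 then show ?case using zero_object_exists by simp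
next
  case (11 A B) then show ?case using biproduct_exists[of A B] by simp blast
next
  case 12 then show ?case by (simp add: Ext_abelian_group)
next
  case 13 then show ?case by (simp only: opp_simps Emap_hom)
next
  case 14 then show ?case by (simp add: Emap_ident)
next
  case (15 Z Z' Z'' X X' X'' g g' f f' \<delta>)
  then show ?case using Emap_comp[of X X' X'' Z Z' Z'' f f' g g' \<delta>] by simp
next
  case 16 then show ?case by (simp add: Emap_add_right)
next
  case 17 then show ?case by (simp add: Emap_add_left)
qed

context additive_bifunctor
begin

lemma opp_sequences: "sequences (opp C) X Z = (\<lambda>(f, Y, g). (g, Y, f)) ` sequences C Z X"
  by (force simp: sequences_def)

lemma isoE:
  assumes "is_iso C X Y h" "X \<in> Obj C" "Y \<in> Obj C"
  obtains k where "arr C h" "src C h = X" "tgt C h = Y" "arr C k" "src C k = Y" "tgt C k = X"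
    "k \<cdot> h = ident C X" "h \<cdot> k = ident C Y"
  using assms unfolding is_iso_def by (auto simp: Hom_iff)

lemma isoI:
  assumes "arr C h" "src C h = X" "tgt C h = Y" "arr C k" "src C k = Y" "tgt C k = X"
    "k \<cdot> h = ident C X" "h \<cdot> k = ident C Y"
  shows "is_iso C X Y h"
  using assms arr_Hom[of h] arr_Hom[of k] unfolding is_iso_def by auto

text \<open>
  An equivalence of sequences reverses its direction when it is read in the opposite category;
  the inverse isomorphism takes its place.
\<close>

lemma seq_equiv_opp:
  assumes "X \<in> Obj C" "Z \<in> Obj C" "((f, Y, g), (f', Y', g')) \<in> seq_equiv C Z X"
  shows "((g, Y, f), (g', Y', f')) \<in> seq_equiv (opp C) X Z"
proof -
  from assms(3) obtain h where s: "(f, Y, g) \<in> sequences C Z X" "(f', Y', g') \<in> sequences C Z X"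
    and h: "is_iso C Y Y' h" "h \<cdot> f = f'" "g' \<cdot> h = g"
    unfolding seq_equiv_def by blast
  have [simp]: "Y \<in> Obj C" "Y' \<in> Obj C" using s unfolding sequences_def by auto
  have [simp]: "arr C f" "src C f = Z" "tgt C f = Y" "arr C g" "src C g = Y" "tgt C g = X"
    "arr C g'" "src C g' = Y'" "tgt C g' = X"
    using s assms(1,2) unfolding sequences_def by (auto simp: Hom_iff)
  from h(1) obtain k where k [simp]: "arr C h" "src C h = Y" "tgt C h = Y'" "arr C k" "src C k = Y'" "tgt C k = Y"
    "k \<cdot> h = ident C Y" "h \<cdot> k = ident C Y'"
    by (rule isoE) simp_all
  have "is_iso C Y' Y k" by (rule isoI[of _ _ _ h]) simp_all
  moreover have "k \<cdot> f' = f" unfolding h(2)[symmetric] by (simp add: reassoc[OF k(7)])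
  moreover have "g \<cdot> k = g'" unfolding h(3)[symmetric] by simp
  ultimately show ?thesis using s unfolding seq_equiv_def
    by (auto simp: opp_sequences)
qed

end

lemma opp_opp: "opp (opp C) = C"
proof -
  have "(\<lambda>(f, Y, g). (g, Y, f)) ` (\<lambda>(f, Y, g). (g, Y, f)) ` A = A" for A :: "('b \<times> 'a \<times> 'b) set"
    by (force simp: image_iff)
  then show ?thesis by (simp add: opp_def)
qed

lemma (in additive_bifunctor) opp_seq_equiv:
  assumes "X \<in> Obj C" "Z \<in> Obj C"
  shows "((f, Y, g), (f', Y', g')) \<in> seq_equiv (opp C) X Z \<longleftrightarrow>
    ((g, Y, f), (g', Y', f')) \<in> seq_equiv C Z X"
  using seq_equiv_opp[of X Z g Y f g' Y' f'] assms
    additive_bifunctor.seq_equiv_opp[OF opp_additive_bifunctor, of Z X f Y g f' Y' g']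
  by (auto simp: opp_opp)

context additive_realization
begin

lemma etriangleD:
  assumes "etriangle C X f Y g Z \<delta>"
  shows "X \<in> Obj C" "Y \<in> Obj C" "Z \<in> Obj C" "arr C f" "src C f = X" "tgt C f = Y"
    "arr C g" "src C g = Y" "tgt C g = Z" "\<delta> \<in> carrier (Ext C Z X)"
  using assms unfolding etriangle_def by (auto simp: Hom_iff)

lemma opp_additive_realization: "additive_realization (opp C)"
proof (rule additive_realization.intro[OF opp_additive_bifunctor additive_realization_axioms.intro], goal_cases)
  case (1 Z X \<delta>)
  then obtain x where x: "x \<in> sequences C Z X" "realize C X Z \<delta> = seq_equiv C Z X `` {x}"
    using realize_class[of X Z \<delta>] by (auto elim: quotientE)
  obtain f Y g where [simp]: "x = (f, Y, g)" by (cases x)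
  then have "realize (opp C) Z X \<delta> = seq_equiv (opp C) X Z `` {(g, Y, f)}"
    using 1 x(2) by (auto simp: opp_seq_equiv)
  moreover have "(g, Y, f) \<in> sequences (opp C) X Z" using x(1) by (force simp: opp_sequences)
  ultimately show ?case by (auto intro: quotientI)
next
  case (2 X f Y g Z \<delta> X' f' Y' g' Z' \<delta>' \<alpha> \<gamma>)
  then show ?case using realize_morphism[of Z' g' Y' f' X' \<delta>' Z g Y f X \<delta> \<gamma> \<alpha>] by auto
next
  case (3 X Z P i j p q)
  then show ?case using realize_zero[of Z X P q p j i] biproduct_swap[of X Z P p q i j] by simp
next
  case (4 X f Y g Z \<delta> X' f' Y' g' Z' \<delta>' SX iX iX' pX pX' SY iY iY' pY pY' SZ iZ iZ' pZ pZ')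
  note [simp] = etriangleD[OF 4(1)[simplified]] etriangleD[OF 4(2)[simplified]]
    biproductD[OF 4(3)[simplified]] biproductD[OF 4(4)[simplified]] biproductD[OF 4(5)[simplified]]
  show ?case
    using realize_sum[OF 4(1)[simplified] 4(2)[simplified] 4(5)[simplified] 4(4)[simplified] 4(3)[simplified]]
    by (simp add: map_sum_def ext_sum_def)
qed

end

text \<open>
  ET3 and ET4 are exchanged with their dual forms; in ET4 the two given triangles swap their
  roles.
\<close>

lemma (in extriangulated_category) opp_extriangulated_category: "extriangulated_category (opp C)"
proof (rule extriangulated_category.intro[OF opp_additive_realization extriangulated_category_axioms.intro], goal_cases)
  case (1 X f Y g Z \<delta> X' f' Y' g' Z' \<delta>' \<alpha> \<beta>)
  then show ?case using ET3_op[of Z' g' Y' f' X' \<delta>' Z g Y f X \<delta> \<beta> \<alpha>]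
    unfolding opp_etriangle_morphism by simp
next
  case (2 X f Y g Z \<delta> X' f' Y' g' Z' \<delta>' \<beta> \<gamma>)
  then show ?case using ET3[of Z' g' Y' f' X' \<delta>' Z g Y f X \<delta> \<gamma> \<beta>]
    unfolding opp_etriangle_morphism by simp
next
  case (3 A f B g D \<delta> u K v E \<epsilon>)
  then have "etriangle C E v K u B \<epsilon>" "etriangle C D g B f A \<delta>" by simp_all
  from ET4_op[OF this] show ?case unfolding opp_etriangle opp_simps by metis
next
  case (4 A m K h F \<theta> D w q E \<eta>)
  then have "etriangle C E q F w D \<eta>" "etriangle C F h K m A \<theta>" by simp_all
  from ET4[OF this] show ?case unfolding opp_etriangle opp_simps by metis
qed

section \<open>Functoriality of extensions\<close>

context additive_bifunctor
begin

lemma Emap_closed: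
  assumes "arr C g" "arr C f" "\<delta> \<in> carrier (Ext C (tgt C g) (src C f))"
  shows "Emap C g f \<delta> \<in> carrier (Ext C (src C g) (tgt C f))"
  using Emap_hom[of "tgt C g" "src C g" "src C f" "tgt C f" g f] assms arr_Hom[of f] arr_Hom[of g]
  by (auto simp: hom_def)

lemma pull_closed [simp]:
  "arr C g \<Longrightarrow> src C g = Z' \<Longrightarrow> X \<in> Obj C \<Longrightarrow> \<delta> \<in> carrier (Ext C (tgt C g) X)
    \<Longrightarrow> pull C X g \<delta> \<in> carrier (Ext C Z' X)"
  using Emap_closed[of g "ident C X" \<delta>] by (auto simp: pull_def)

lemma push_closed [simp]:
  "arr C f \<Longrightarrow> tgt C f = X' \<Longrightarrow> Z \<in> Obj C \<Longrightarrow> \<delta> \<in> carrier (Ext C Z (src C f))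
    \<Longrightarrow> push C Z f \<delta> \<in> carrier (Ext C Z X')"
  using Emap_closed[of "ident C Z" f \<delta>] by (auto simp: push_def)

lemma zero_ext [simp]: "Z \<in> Obj C \<Longrightarrow> X \<in> Obj C \<Longrightarrow> \<zero>\<^bsub>Ext C Z X\<^esub> \<in> carrier (Ext C Z X)"
  by (simp add: Ext_abelian_group abelian_group.axioms(1) abelian_monoid.zero_closed)

lemma ext_add_self_zero:
  assumes "x \<oplus>\<^bsub>Ext C Z X\<^esub> x = x" "x \<in> carrier (Ext C Z X)" "Z \<in> Obj C" "X \<in> Obj C"
  shows "x = \<zero>\<^bsub>Ext C Z X\<^esub>"
proof -
  interpret G: abelian_group "Ext C Z X" using assms(3,4) by (rule Ext_abelian_group)
  show ?thesis using assms(1,2) G.add.l_cancel_one by metis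
qed

lemma pull_ident [simp]:
  "Z \<in> Obj C \<Longrightarrow> X \<in> Obj C \<Longrightarrow> \<delta> \<in> carrier (Ext C Z X) \<Longrightarrow> pull C X (ident C Z) \<delta> = \<delta>"
  by (simp add: pull_def Emap_ident)

lemma push_ident [simp]:
  "Z \<in> Obj C \<Longrightarrow> X \<in> Obj C \<Longrightarrow> \<delta> \<in> carrier (Ext C Z X) \<Longrightarrow> push C Z (ident C X) \<delta> = \<delta>"
  by (simp add: push_def Emap_ident)

lemma pull_pull [simp]:
  assumes "arr C g" "arr C g'" "src C g = tgt C g'" "X \<in> Obj C" "\<delta> \<in> carrier (Ext C (tgt C g) X)"
  shows "pull C X g' (pull C X g \<delta>) = pull C X (g \<cdot> g') \<delta>"
  using Emap_comp[of "tgt C g" "src C g" "src C g'" X X X g g' "ident C X" "ident C X" \<delta>]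
    assms arr_Hom[of g] arr_Hom[of g'] by (simp add: pull_def ident_closed)

lemma push_push [simp]:
  assumes "arr C f" "arr C f'" "src C f' = tgt C f" "Z \<in> Obj C" "\<delta> \<in> carrier (Ext C Z (src C f))"
  shows "push C Z f' (push C Z f \<delta>) = push C Z (f' \<cdot> f) \<delta>"
  using Emap_comp[of Z Z Z "src C f" "tgt C f" "tgt C f'" "ident C Z" "ident C Z" f f' \<delta>]
    assms arr_Hom[of f] arr_Hom[of f'] by (simp add: push_def ident_closed)

lemma Emap_eq_pull_push:
  assumes "arr C g" "arr C f" "tgt C f = X'" "tgt C g = Z" "\<delta> \<in> carrier (Ext C Z (src C f))"
  shows "Emap C g f \<delta> = pull C X' g (push C Z f \<delta>)"
  using Emap_comp[of Z Z "src C g" "src C f" X' X' "ident C Z" g f "ident C X'" \<delta>]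
    assms arr_Hom[of f] arr_Hom[of g] arr_Obj[of g] arr_Obj[of f]
  by (auto simp: push_def pull_def ident_closed)

lemma push_pull:
  assumes "arr C g" "arr C f" "src C f = X" "tgt C f = X'" "src C g = Z'" "tgt C g = Z"
    "\<delta> \<in> carrier (Ext C Z X)"
  shows "push C Z' f (pull C X g \<delta>) = pull C X' g (push C Z f \<delta>)"
  using Emap_comp[of Z Z' Z' X X X' g "ident C Z'" "ident C X" f \<delta>] Emap_eq_pull_push[of g f X' Z \<delta>]
    assms arr_Hom[of f] arr_Hom[of g] arr_Obj[of g] arr_Obj[of f]
  by (auto simp: push_def pull_def ident_closed)

lemma pull_madd:
  assumes "arr C g" "arr C g'" "src C g = Z'" "src C g' = Z'" "tgt C g' = tgt C g" "X \<in> Obj C"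
    "\<delta> \<in> carrier (Ext C (tgt C g) X)"
  shows "pull C X (g \<boxplus> g') \<delta> = pull C X g \<delta> \<oplus>\<^bsub>Ext C Z' X\<^esub> pull C X g' \<delta>"
  using Emap_add_left[of "tgt C g" "src C g" X X g g' "ident C X" \<delta>]
    assms arr_Hom[of g] arr_Hom[of g'] arr_Obj[of g] by (simp add: pull_def ident_closed madd_conv)

lemma pull_zmor [simp]:
  assumes "Z' \<in> Obj C" "Z \<in> Obj C" "X \<in> Obj C" "\<delta> \<in> carrier (Ext C Z X)"
  shows "pull C X (zmor C Z' Z) \<delta> = \<zero>\<^bsub>Ext C Z' X\<^esub>"
  using pull_madd[of "zmor C Z' Z" "zmor C Z' Z" Z' X \<delta>] assms
  by (intro ext_add_self_zero) simp_all

lemma push_zmor [simp]: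
  assumes "Z \<in> Obj C" "X \<in> Obj C" "X' \<in> Obj C" "\<delta> \<in> carrier (Ext C Z X)"
  shows "push C Z (zmor C X X') \<delta> = \<zero>\<^bsub>Ext C Z X'\<^esub>"
  using additive_bifunctor.pull_zmor[OF opp_additive_bifunctor, of X' X Z \<delta>] assms by simp

lemma Emap_zero [simp]:
  assumes "arr C g" "arr C f" "tgt C g = Z" "src C f = X"
  shows "Emap C g f \<zero>\<^bsub>Ext C Z X\<^esub> = \<zero>\<^bsub>Ext C (src C g) (tgt C f)\<^esub>"
proof (rule ext_add_self_zero)
  have o: "Z \<in> Obj C" "X \<in> Obj C" using assms arr_Obj by blast+
  interpret G: abelian_group "Ext C Z X" using o by (rule Ext_abelian_group)
  have "Emap C g f \<in> hom (add_monoid (Ext C Z X)) (add_monoid (Ext C (src C g) (tgt C f)))"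
    using Emap_hom[of Z "src C g" X "tgt C f" g f] assms o arr_Hom[of f] arr_Hom[of g] by simp
  from hom_mult[OF this, of "\<zero>\<^bsub>Ext C Z X\<^esub>" "\<zero>\<^bsub>Ext C Z X\<^esub>"]
  show "Emap C g f \<zero>\<^bsub>Ext C Z X\<^esub> \<oplus>\<^bsub>Ext C (src C g) (tgt C f)\<^esub> Emap C g f \<zero>\<^bsub>Ext C Z X\<^esub> =
    Emap C g f \<zero>\<^bsub>Ext C Z X\<^esub>" by simp
  show "Emap C g f \<zero>\<^bsub>Ext C Z X\<^esub> \<in> carrier (Ext C (src C g) (tgt C f))"
    using Emap_closed[of g f "\<zero>\<^bsub>Ext C Z X\<^esub>"] assms o by simp
qed (use assms in simp_all)

lemma pull_zero [simp]:
  "arr C g \<Longrightarrow> tgt C g = Z \<Longrightarrow> X \<in> Obj C \<Longrightarrow> pull C X g \<zero>\<^bsub>Ext C Z X\<^esub> = \<zero>\<^bsub>Ext C (src C g) X\<^esub>"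
  by (simp add: pull_def)

lemma push_zero [simp]:
  "arr C f \<Longrightarrow> src C f = X \<Longrightarrow> Z \<in> Obj C \<Longrightarrow> push C Z f \<zero>\<^bsub>Ext C Z X\<^esub> = \<zero>\<^bsub>Ext C Z (tgt C f)\<^esub>"
  by (simp add: push_def)

lemma pull_diff_zero:
  assumes "pull C X g \<delta> = pull C X g' \<delta>" "arr C g" "arr C g'" "src C g = Z'" "src C g' = Z'"
    "tgt C g = Z" "tgt C g' = Z" "X \<in> Obj C" "\<delta> \<in> carrier (Ext C Z X)"
  shows "pull C X (g \<boxplus> \<boxminus> g') \<delta> = \<zero>\<^bsub>Ext C Z' X\<^esub>"
proof -
  have [simp]: "Z \<in> Obj C" "Z' \<in> Obj C" using assms arr_Obj by blast+
  have "pull C X (g \<boxplus> \<boxminus> g') \<delta> = pull C X (g' \<boxplus> \<boxminus> g') \<delta>"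
    using assms pull_madd[of g "\<boxminus> g'" Z' X \<delta>] pull_madd[of g' "\<boxminus> g'" Z' X \<delta>] by simp
  then show ?thesis using assms by simp
qed

text \<open>
  If \<open>u = e - 1\<close> has square zero, then \<open>e = 1 + u\<close> has the inverse \<open>1 - u = 2 - e\<close>.
\<close>

lemma unipotent_inverse:
  assumes "arr C e" "src C e = Y" "tgt C e = Y" and
    sq: "(e \<boxplus> \<boxminus> ident C Y) \<cdot> (e \<boxplus> \<boxminus> ident C Y) = zmor C Y Y"
  shows "e \<cdot> (ident C Y \<boxplus> (ident C Y \<boxplus> \<boxminus> e)) = ident C Y" "(ident C Y \<boxplus> (ident C Y \<boxplus> \<boxminus> e)) \<cdot> e = ident C Y"
proof -
  note [simp] = assms(1-3)
  have [simp]: "Y \<in> Obj C" using assms arr_Obj by blast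
  have "(e \<boxplus> \<boxminus> ident C Y) \<cdot> (e \<boxplus> \<boxminus> ident C Y) = ident C Y \<boxplus> \<boxminus> (e \<boxplus> (e \<boxplus> \<boxminus> (e \<cdot> e)))"
    by (simp add: madd_ac)
  from trans[OF this[symmetric] sq]
  have "ident C Y \<boxplus> \<boxminus> (e \<boxplus> (e \<boxplus> \<boxminus> (e \<cdot> e))) = zmor C (src C (ident C Y)) (tgt C (ident C Y))"
    by (simp del: mneg_madd)
  then have "ident C Y = e \<boxplus> (e \<boxplus> \<boxminus> (e \<cdot> e))"
    by (rule eq_if_diff_zero) simp_all
  from this[symmetric] show "e \<cdot> (ident C Y \<boxplus> (ident C Y \<boxplus> \<boxminus> e)) = ident C Y"
    "(ident C Y \<boxplus> (ident C Y \<boxplus> \<boxminus> e)) \<cdot> e = ident C Y" by simp_all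
qed

lemma iso_if_both_composites_iso:
  assumes "arr C b" "src C b = Y" "tgt C b = Y'"
    "arr C l" "src C l = Y'" "tgt C l = Y" "l \<cdot> b = ident C Y"
    "arr C r" "src C r = Y'" "tgt C r = Y" "b \<cdot> r = ident C Y'"
  shows "is_iso C Y Y' b"
proof -
  note [simp] = assms
  have "r = (l \<cdot> b) \<cdot> r" by simp
  also have "\<dots> = l" by (simp del: assms(7))
  finally have rl: "r = l" .
  have "b \<cdot> l = ident C Y'" unfolding rl[symmetric] by simp
  then show ?thesis by (intro isoI[of _ _ _ l]) auto
qed

end

section \<open>Exactness and isomorphisms of triangles\<close>

context extriangulated_category
begin

lemma split_triangle_zero_left:
  assumes "is_zero_object C N" "B \<in> Obj C"
  shows "etriangle C N (zmor C N B) B (ident C B) B \<zero>\<^bsub>Ext C B N\<^esub>"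
  using realize_zero[OF biproduct_zero_left[OF assms]] .

lemma split_triangle_zero_right:
  assumes "is_zero_object C N" "B \<in> Obj C"
  shows "etriangle C B (ident C B) B (zmor C B N) N \<zero>\<^bsub>Ext C N B\<^esub>"
  using realize_zero[OF biproduct_swap[OF biproduct_zero_left[OF assms]]] .

lemma ET3E:
  assumes "etriangle C X f Y g Z \<delta>" "etriangle C X' f' Y' g' Z' \<delta>'"
    "arr C \<alpha>" "src C \<alpha> = X" "tgt C \<alpha> = X'" "arr C \<beta>" "src C \<beta> = Y" "tgt C \<beta> = Y'" "\<beta> \<cdot> f = f' \<cdot> \<alpha>"
  obtains \<gamma> where "arr C \<gamma>" "src C \<gamma> = Z" "tgt C \<gamma> = Z'" "g' \<cdot> \<beta> = \<gamma> \<cdot> g" "push C Z \<alpha> \<delta> = pull C X' \<gamma> \<delta>'"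
proof -
  have "\<alpha> \<in> Hom C X X'" "\<beta> \<in> Hom C Y Y'" using assms arr_Hom[of \<alpha>] arr_Hom[of \<beta>] by auto
  from ET3[OF assms(1,2) this assms(9)] obtain \<gamma> where
    *: "etriangle_morphism C (X, f, Y, g, Z, \<delta>) (X', f', Y', g', Z', \<delta>') (\<alpha>, \<beta>, \<gamma>)" by blast
  have "Z \<in> Obj C" "Z' \<in> Obj C" using etriangleD[OF assms(1)] etriangleD[OF assms(2)] by blast+
  then show thesis using that[of \<gamma>] * by (auto simp: Hom_iff)
qed

lemma realize_morphismE:
  assumes "etriangle C X f Y g Z \<delta>" "etriangle C X' f' Y' g' Z' \<delta>'"
    "arr C \<alpha>" "src C \<alpha> = X" "tgt C \<alpha> = X'" "arr C \<gamma>" "src C \<gamma> = Z" "tgt C \<gamma> = Z'"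
    "push C Z \<alpha> \<delta> = pull C X' \<gamma> \<delta>'"
  obtains \<beta> where "arr C \<beta>" "src C \<beta> = Y" "tgt C \<beta> = Y'" "\<beta> \<cdot> f = f' \<cdot> \<alpha>" "g' \<cdot> \<beta> = \<gamma> \<cdot> g"
proof -
  have "\<alpha> \<in> Hom C X X'" "\<gamma> \<in> Hom C Z Z'" using assms arr_Hom[of \<alpha>] arr_Hom[of \<gamma>] by auto
  from realize_morphism[OF assms(1,2) this assms(9)] obtain \<beta> where
    *: "\<beta> \<in> Hom C Y Y'" "\<beta> \<cdot> f = f' \<cdot> \<alpha>" "g' \<cdot> \<beta> = \<gamma> \<cdot> g" by blast
  have "Y \<in> Obj C" "Y' \<in> Obj C" using etriangleD[OF assms(1)] etriangleD[OF assms(2)] by blast+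
  then show thesis using that[of \<beta>] * by (auto simp: Hom_iff)
qed

text \<open>
  By ET3 the identity of \<open>X\<close> and \<open>f\<close> extend to a morphism from the triangle \<open>X = X \<rightarrow> 0\<close>, and so
  \<open>g \<cdot> f\<close> factors through a zero object. The exactness properties are proved by the same
  comparison, with \<open>Y = Y \<rightarrow> 0\<close> or with \<open>0 \<rightarrow> D = D\<close>.
\<close>

lemma etriangle_comp_zero:
  assumes "etriangle C X f Y g Z \<delta>"
  shows "g \<cdot> f = zmor C X Z"
proof -
  note [simp] = etriangleD[OF assms]
  obtain N where N: "is_zero_object C N" using zero_object_exists by blast
  then have [simp]: "N \<in> Obj C" unfolding is_zero_object_def by blast
  obtain \<gamma> where g: "arr C \<gamma>" "src C \<gamma> = N" "tgt C \<gamma> = Z" "g \<cdot> f = \<gamma> \<cdot> zmor C X N"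
    using ET3E[OF split_triangle_zero_right[OF N etriangleD(1)[OF assms]] assms, of "ident C X" f] by auto
  then show ?thesis by simp
qed

lemma etriangle_comp_zero':
  assumes "etriangle C X f Y g Z \<delta>" "arr C x" "tgt C x = X"
  shows "g \<cdot> (f \<cdot> x) = zmor C (src C x) Z"
  using etriangleD[OF assms(1)] assms(2-)
  by (simp add: reassoc[OF etriangle_comp_zero[OF assms(1)]])

lemma etriangle_push_zero:
  assumes "etriangle C X f Y g Z \<delta>"
  shows "push C Z f \<delta> = \<zero>\<^bsub>Ext C Z Y\<^esub>"
proof -
  note [simp] = etriangleD[OF assms]
  obtain N where N: "is_zero_object C N" using zero_object_exists by blast
  then have [simp]: "N \<in> Obj C" unfolding is_zero_object_def by blast
  obtain \<gamma> where "arr C \<gamma>" "src C \<gamma> = Z" "tgt C \<gamma> = N" "push C Z f \<delta> = pull C Y \<gamma> \<zero>\<^bsub>Ext C N Y\<^esub>"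
    by (rule ET3E[OF assms split_triangle_zero_right[OF N etriangleD(2)[OF assms]], of f "ident C Y"]) simp_all
  then show ?thesis by simp
qed

lemma weak_cokernel:
  assumes "etriangle C X f Y g Z \<delta>" "arr C h" "src C h = Y" "tgt C h = D" "h \<cdot> f = zmor C X D"
  obtains k where "arr C k" "src C k = Z" "tgt C k = D" "h = k \<cdot> g"
proof -
  note [simp] = etriangleD[OF assms(1)] assms(2-4)
  obtain N where N: "is_zero_object C N" using zero_object_exists by blast
  then have [simp]: "N \<in> Obj C" unfolding is_zero_object_def by blast
  have [simp]: "D \<in> Obj C" using arr_Obj[OF assms(2)] by simp
  obtain \<gamma> where "arr C \<gamma>" "src C \<gamma> = Z" "tgt C \<gamma> = D" "ident C D \<cdot> h = \<gamma> \<cdot> g"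
    by (rule ET3E[OF assms(1) split_triangle_zero_left[OF N, of D], of "zmor C X N" h])
      (simp_all add: assms(5))
  then show thesis using that[of \<gamma>] by simp
qed

lemma lift_along_deflation:
  assumes "etriangle C X f Y g Z \<delta>" "arr C c" "src C c = W" "tgt C c = Z" "pull C X c \<delta> = \<zero>\<^bsub>Ext C W X\<^esub>"
  obtains k where "arr C k" "src C k = W" "tgt C k = Y" "c = g \<cdot> k"
proof -
  note [simp] = etriangleD[OF assms(1)] assms(2-5)
  obtain N where N: "is_zero_object C N" using zero_object_exists by blast
  then have [simp]: "N \<in> Obj C" unfolding is_zero_object_def by blast
  have [simp]: "W \<in> Obj C" using arr_Obj[OF assms(2)] by simp
  obtain \<beta> where "arr C \<beta>" "src C \<beta> = W" "tgt C \<beta> = Y" "g \<cdot> \<beta> = c \<cdot> ident C W"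
    by (rule realize_morphismE[OF split_triangle_zero_left[OF N, of W] assms(1), of "zmor C N X" c])
      simp_all
  then show thesis using that[of \<beta>] by simp
qed

lemma etriangle_pull_zero:
  assumes "etriangle C X f Y g Z \<delta>"
  shows "pull C X g \<delta> = \<zero>\<^bsub>Ext C Y X\<^esub>"
  using extriangulated_category.etriangle_push_zero[OF opp_extriangulated_category, of Z g Y f X \<delta>] assms by simp

lemma weak_kernel:
  assumes "etriangle C X f Y g Z \<delta>" "arr C h" "src C h = W" "tgt C h = Y" "g \<cdot> h = zmor C W Z"
  obtains k where "arr C k" "src C k = W" "tgt C k = X" "h = f \<cdot> k"
  using extriangulated_category.weak_cokernel[OF opp_extriangulated_category, of Z g Y f X \<delta> h W] assms by auto

lemma extend_along_inflation:
  assumes "etriangle C X f Y g Z \<delta>" "arr C c" "src C c = X" "tgt C c = W" "push C Z c \<delta> = \<zero>\<^bsub>Ext C Z W\<^esub>"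
  obtains k where "arr C k" "src C k = Y" "tgt C k = W" "c = k \<cdot> f"
  using extriangulated_category.lift_along_deflation[OF opp_extriangulated_category, of Z g Y f X \<delta> c W] assms by auto

text \<open>
  The next two lemmas are the five lemma for an endomorphism of a triangle that is the identity
  on the other two terms. By exactness \<open>e - 1\<close> factors through a map which it kills, so it has square
  zero.
\<close>

lemma endo_iso_of_middle:
  assumes t: "etriangle C X f Y g Z \<delta>" and e: "arr C e" "src C e = Y" "tgt C e = Y" "e \<cdot> f = f" "g \<cdot> e = g"
  obtains k where "arr C k" "src C k = Y" "tgt C k = Y" "e \<cdot> k = ident C Y" "k \<cdot> e = ident C Y"
proof -
  note [simp] = etriangleD[OF t] e
  let ?u = "e \<boxplus> \<boxminus> ident C Y"
  obtain v where [simp]: "arr C v" "src C v = Z" "tgt C v = Y" and u: "?u = v \<cdot> g"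
    by (rule weak_cokernel[OF t, of ?u Y]) (blast | (simp; fail))+
  have "g \<cdot> ?u = zmor C Y Z" by simp
  then have "?u \<cdot> ?u = zmor C Y Y" unfolding u by simp
  from unipotent_inverse[OF e(1-3) this] show thesis
    by (intro that[of "ident C Y \<boxplus> (ident C Y \<boxplus> \<boxminus> e)"]) simp_all
qed

lemma endo_iso_of_right:
  assumes t: "etriangle C X f Y g Z \<delta>" and e: "arr C e" "src C e = Z" "tgt C e = Z" "e \<cdot> g = g"
    "pull C X e \<delta> = \<delta>"
  obtains k where "arr C k" "src C k = Z" "tgt C k = Z" "e \<cdot> k = ident C Z" "k \<cdot> e = ident C Z"
proof -
  note [simp] = etriangleD[OF t] e(1-4)
  let ?u = "e \<boxplus> \<boxminus> ident C Z"
  have "pull C X ?u \<delta> = \<zero>\<^bsub>Ext C Z X\<^esub>" by (rule pull_diff_zero[of _ _ _ _ _ Z]) (simp_all add: e(5))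
  then obtain v where [simp]: "arr C v" "src C v = Z" "tgt C v = Y" and u: "?u = g \<cdot> v"
    by (rule lift_along_deflation[OF t, of ?u Z, rotated 3]) (blast | (simp; fail))+
  have "?u \<cdot> g = zmor C Y Z" by simp
  then have "?u \<cdot> (g \<cdot> v) = zmor C Y Z \<cdot> v" by (rule reassoc) simp_all
  also have "\<dots> = zmor C Z Z" by simp
  finally have "?u \<cdot> (g \<cdot> v) = zmor C Z Z" .
  then have "?u \<cdot> ?u = zmor C Z Z" unfolding u .
  from unipotent_inverse[OF e(1-3) this] show thesis
    by (intro that[of "ident C Z \<boxplus> (ident C Z \<boxplus> \<boxminus> e)"]) simp_all
qed

text \<open>
  ET3 gives comparison maps in both directions; their composites are invertible by the
  five lemma.
\<close>

lemma cofiber_unique: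
  assumes t: "etriangle C X f Y g Z \<delta>" and t': "etriangle C X f Y g' Z' \<delta>'"
  obtains \<phi> \<psi> where "arr C \<phi>" "src C \<phi> = Z" "tgt C \<phi> = Z'" "arr C \<psi>" "src C \<psi> = Z'" "tgt C \<psi> = Z"
    "\<psi> \<cdot> \<phi> = ident C Z" "\<phi> \<cdot> \<psi> = ident C Z'" "\<phi> \<cdot> g = g'" "pull C X \<phi> \<delta>' = \<delta>"
proof -
  note [simp] = etriangleD[OF t] etriangleD[OF t']
  obtain c where c [simp]: "arr C c" "src C c = Z" "tgt C c = Z'" and c': "g' \<cdot> ident C Y = c \<cdot> g"
    "push C Z (ident C X) \<delta> = pull C X c \<delta>'"
    by (rule ET3E[OF t t', of "ident C X" "ident C Y"]) (blast | (simp; fail))+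
  obtain d where d [simp]: "arr C d" "src C d = Z'" "tgt C d = Z" and d': "g \<cdot> ident C Y = d \<cdot> g'"
    "push C Z' (ident C X) \<delta>' = pull C X d \<delta>"
    by (rule ET3E[OF t' t, of "ident C X" "ident C Y"]) (blast | (simp; fail))+
  have [simp]: "c \<cdot> g = g'" "d \<cdot> g' = g" and cp: "pull C X c \<delta>' = \<delta>" and dp: "pull C X d \<delta> = \<delta>'"
    using c' d' by simp_all
  obtain k where k [simp]: "arr C k" "src C k = Z" "tgt C k = Z" "k \<cdot> (d \<cdot> c) = ident C Z"
  proof (rule endo_iso_of_right[OF t, of "d \<cdot> c"])
    show "pull C X (d \<cdot> c) \<delta> = \<delta>" using cp dp by (metis pull_pull c d etriangleD t t')
  qed (blast | (simp; fail))+
  obtain l where l [simp]: "arr C l" "src C l = Z'" "tgt C l = Z'" and l': "(c \<cdot> d) \<cdot> l = ident C Z'"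
  proof (rule endo_iso_of_right[OF t', of "c \<cdot> d"])
    show "pull C X (c \<cdot> d) \<delta>' = \<delta>'" using cp dp by (metis pull_pull c d etriangleD t t')
  qed (blast | (simp; fail))+
  have [simp]: "c \<cdot> (d \<cdot> l) = ident C Z'" using l' by simp
  have "is_iso C Z Z' c"
    by (rule iso_if_both_composites_iso[where l = "k \<cdot> d" and r = "d \<cdot> l"]) simp_all
  then obtain c' where "arr C c'" "src C c' = Z'" "tgt C c' = Z" "c' \<cdot> c = ident C Z" "c \<cdot> c' = ident C Z'"
    by (rule isoE) simp_all
  then show thesis using that[of c c'] cp c by simp
qed

lemma etriangle_iso_middle:
  assumes t: "etriangle C X f Y g Z \<delta>" and h: "arr C h" "src C h = Y" "tgt C h = Y'"
    "arr C k" "src C k = Y'" "tgt C k = Y" "k \<cdot> h = ident C Y" "h \<cdot> k = ident C Y'"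
  shows "etriangle C X (h \<cdot> f) Y' (g \<cdot> k) Z \<delta>"
proof -
  note [simp] = etriangleD[OF t] h
  have [simp]: "Y' \<in> Obj C" using arr_Obj[OF h(1)] by simp
  obtain x where x: "realize C Z X \<delta> = seq_equiv C X Z `` {x}"
    using realize_class[of Z X \<delta>] by (auto elim: quotientE)
  obtain f0 Y0 g0 where x0: "x = (f0, Y0, g0)" by (cases x)
  have "(x, (f, Y, g)) \<in> seq_equiv C X Z" using t x unfolding etriangle_def by auto
  then obtain h0 where s: "(f0, Y0, g0) \<in> sequences C X Z" and h0: "is_iso C Y0 Y h0" "h0 \<cdot> f0 = f" "g \<cdot> h0 = g0"
    unfolding seq_equiv_def x0 by auto
  have [simp]: "Y0 \<in> Obj C" "arr C f0" "src C f0 = X" "tgt C f0 = Y0" "arr C g0" "src C g0 = Y0" "tgt C g0 = Z"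
    using s unfolding sequences_def by (auto simp: Hom_iff)
  obtain k0 where k0 [simp]: "arr C h0" "src C h0 = Y0" "tgt C h0 = Y" "arr C k0" "src C k0 = Y" "tgt C k0 = Y0"
    "k0 \<cdot> h0 = ident C Y0" "h0 \<cdot> k0 = ident C Y"
    using isoE[OF h0(1)] by auto
  have "is_iso C Y0 Y' (h \<cdot> h0)"
    by (rule isoI[of _ _ _ "k0 \<cdot> k"]) (simp_all add: reassoc[OF h(7)] reassoc[OF k0(8)])
  moreover have "(h \<cdot> f, Y', g \<cdot> k) \<in> sequences C X Z" unfolding sequences_def by (simp add: Hom_iff)
  moreover have "(h \<cdot> h0) \<cdot> f0 = h \<cdot> f" "(g \<cdot> k) \<cdot> (h \<cdot> h0) = g0"
    by (simp_all add: h0(2,3) reassoc[OF h(7)])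
  ultimately have "(x, (h \<cdot> f, Y', g \<cdot> k)) \<in> seq_equiv C X Z" using s unfolding seq_equiv_def x0 by blast
  then show ?thesis using x unfolding etriangle_def by (simp add: Hom_iff)
qed

lemma realization_exists:
  assumes "\<delta> \<in> carrier (Ext C Z X)" "Z \<in> Obj C" "X \<in> Obj C"
  obtains f Y g where "etriangle C X f Y g Z \<delta>"
proof -
  obtain x where x: "x \<in> sequences C X Z" "realize C Z X \<delta> = seq_equiv C X Z `` {x}"
    using realize_class[of Z X \<delta>] assms by (auto elim: quotientE)
  obtain f Y g where x0: "x = (f, Y, g)" by (cases x)
  note [simp] = assms
  have [simp]: "Y \<in> Obj C" "arr C f" "src C f = X" "tgt C f = Y" "arr C g" "src C g = Y" "tgt C g = Z"
    using x(1) unfolding sequences_def x0 by (auto simp: Hom_iff)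
  have "is_iso C Y Y (ident C Y)" by (rule isoI[of _ _ _ "ident C Y"]) simp_all
  moreover have "ident C Y \<cdot> f = f" "g \<cdot> ident C Y = g" by simp_all
  ultimately have "(x, x) \<in> seq_equiv C X Z" using x(1) unfolding seq_equiv_def x0 by blast
  then have "etriangle C X f Y g Z \<delta>" using x unfolding etriangle_def x0 by (auto simp: Hom_iff)
  then show thesis by (rule that)
qed

text \<open>
  A map in the opposite direction exists because realizations are functorial; both composites are
  identities on the ends up to the given isomorphisms.
\<close>

lemma five_middle:
  assumes t: "etriangle C X f Y g Z \<delta>" and t': "etriangle C X' f' Y' g' Z' \<delta>'"
    and a: "arr C a" "src C a = X" "tgt C a = X'" "arr C a'" "src C a' = X'" "tgt C a' = X"
    "a' \<cdot> a = ident C X" "a \<cdot> a' = ident C X'"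
    and c: "arr C c" "src C c = Z" "tgt C c = Z'" "arr C c'" "src C c' = Z'" "tgt C c' = Z"
    "c' \<cdot> c = ident C Z" "c \<cdot> c' = ident C Z'"
    and e: "push C Z a \<delta> = pull C X' c \<delta>'"
    and b: "arr C b" "src C b = Y" "tgt C b = Y'" "b \<cdot> f = f' \<cdot> a" "g' \<cdot> b = c \<cdot> g"
  obtains k where "arr C k" "src C k = Y'" "tgt C k = Y" "k \<cdot> b = ident C Y" "b \<cdot> k = ident C Y'"
proof -
  note [simp] = etriangleD[OF t] etriangleD[OF t'] a c b
  have "push C Z' a' \<delta>' = push C Z' a' (pull C X' c' (pull C X' c \<delta>'))" by simp
  also have "\<dots> = push C Z' a' (pull C X' c' (push C Z a \<delta>))" by (simp only: e)
  also have "\<dots> = pull C X c' \<delta>"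
    by (subst push_pull[where Z = Z and X = X' and X' = X]) simp_all
  finally have e': "push C Z' a' \<delta>' = pull C X c' \<delta>" .
  obtain b' where b': "arr C b'" "src C b' = Y'" "tgt C b' = Y" "b' \<cdot> f' = f \<cdot> a'" "g \<cdot> b' = c' \<cdot> g'"
    by (rule realize_morphismE[OF t' t, of a' c']) (blast | (simp add: e'; fail))+
  note [simp] = b' reassoc[OF b'(4)] reassoc[OF b'(5)] reassoc[OF b(4)] reassoc[OF b(5)]
    reassoc[OF c(7)] reassoc[OF c(8)]
  obtain k where k [simp]: "arr C k" "src C k = Y" "tgt C k = Y" "k \<cdot> (b' \<cdot> b) = ident C Y"
    by (rule endo_iso_of_middle[OF t, of "b' \<cdot> b"]) (blast | (simp; fail))+
  obtain l where l [simp]: "arr C l" "src C l = Y'" "tgt C l = Y'" and l': "(b \<cdot> b') \<cdot> l = ident C Y'"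
    by (rule endo_iso_of_middle[OF t', of "b \<cdot> b'"]) (blast | (simp; fail))+
  have [simp]: "b \<cdot> (b' \<cdot> l) = ident C Y'" using l' by simp
  have "is_iso C Y Y' b"
    by (rule iso_if_both_composites_iso[where l = "k \<cdot> b'" and r = "b' \<cdot> l"]) simp_all
  then obtain c' where "arr C c'" "src C c' = Y'" "tgt C c' = Y" "c' \<cdot> b = ident C Y" "b \<cdot> c' = ident C Y'"
    by (rule isoE) simp_all
  then show thesis by (rule that)
qed

text \<open>
  Realize the transported extension by some sequence. The given isomorphisms extend to the
  middle terms, so this sequence is equivalent to the transported one.
\<close>

lemma etriangle_transport:
  assumes t: "etriangle C X f Y g Z \<delta>"
    and a: "arr C a" "src C a = X" "tgt C a = X'" "arr C a'" "src C a' = X'" "tgt C a' = X"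
    "a' \<cdot> a = ident C X" "a \<cdot> a' = ident C X'"
    and c: "arr C c" "src C c = Z" "tgt C c = Z'" "arr C c'" "src C c' = Z'" "tgt C c' = Z"
    "c' \<cdot> c = ident C Z" "c \<cdot> c' = ident C Z'"
  shows "etriangle C X' (f \<cdot> a') Y (c \<cdot> g) Z' (pull C X' c' (push C Z a \<delta>))"
proof -
  note [simp] = etriangleD[OF t] a c
  let ?d = "pull C X' c' (push C Z a \<delta>)"
  have [simp]: "X' \<in> Obj C" "Z' \<in> Obj C" using arr_Obj(2)[OF a(1)] arr_Obj(2)[OF c(1)] by simp_all
  have "?d \<in> carrier (Ext C Z' X')" by simp
  then obtain f'' Y'' g'' where t'': "etriangle C X' f'' Y'' g'' Z' ?d"
    by (rule realization_exists) simp_all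
  note [simp] = etriangleD(2-9)[OF t'']
  have e: "push C Z a \<delta> = pull C X' c ?d" by simp
  obtain b where b [simp]: "arr C b" "src C b = Y" "tgt C b = Y''" "b \<cdot> f = f'' \<cdot> a" "g'' \<cdot> b = c \<cdot> g"
    by (rule realize_morphismE[OF t t'' a(1-3) c(1-3) e]) blast
  obtain k where k [simp]: "arr C k" "src C k = Y''" "tgt C k = Y" "k \<cdot> b = ident C Y" "b \<cdot> k = ident C Y''"
    by (rule five_middle[OF t t'' a c e b])
  have "etriangle C X' (k \<cdot> f'') Y (g'' \<cdot> b) Z' ?d"
    by (rule etriangle_iso_middle[OF t'']) simp_all
  moreover have "k \<cdot> f'' = f \<cdot> a'"
  proof -
    have "k \<cdot> f'' = k \<cdot> ((f'' \<cdot> a) \<cdot> a')" by simp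
    also have "\<dots> = k \<cdot> ((b \<cdot> f) \<cdot> a')" by (simp only: b)
    also have "\<dots> = f \<cdot> a'" by (simp add: reassoc[OF k(4)] del: b(4))
    finally show ?thesis .
  qed
  ultimately show ?thesis by simp
qed

text \<open>
  A section of the deflation forces \<open>\<delta> = s\<^sup>* g\<^sup>* \<delta> = 0\<close>, whence the inflation has a retraction \<open>r0\<close>. It is
  corrected so as to vanish on the given section.
\<close>

lemma deflation_section_biproduct:
  assumes t: "etriangle C A f B g D \<delta>" and s: "arr C s" "src C s = D" "tgt C s = B" "g \<cdot> s = ident C D"
  obtains r where "is_biproduct C A D B f s r g"
proof -
  note [simp] = etriangleD[OF t] s reassoc[OF s(4)] etriangle_comp_zero[OF t] etriangle_comp_zero'[OF t]
  have "\<delta> = pull C A s (pull C A g \<delta>)" by simp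
  also have "\<dots> = \<zero>\<^bsub>Ext C D A\<^esub>" by (simp add: etriangle_pull_zero[OF t] del: pull_pull)
  finally have d: "\<delta> = \<zero>\<^bsub>Ext C D A\<^esub>" .
  obtain r0 where [simp]: "arr C r0" "src C r0 = B" "tgt C r0 = A" and r0: "ident C A = r0 \<cdot> f"
    by (rule extend_along_inflation[OF t, of "ident C A" A]) (blast | (simp; simp add: d; fail))+
  have r0f: "r0 \<cdot> f = ident C A" using r0 by simp
  have "is_biproduct C A D B f s (r0 \<boxplus> \<boxminus> (r0 \<cdot> (s \<cdot> g))) g"
  proof -
    let ?e = "ident C B \<boxplus> \<boxminus> (s \<cdot> g)"
    have "g \<cdot> ?e = zmor C B D" by simp
    then obtain k where [simp]: "arr C k" "src C k = B" "tgt C k = A" and k: "?e = f \<cdot> k"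
      by (rule weak_kernel[OF t, of ?e B, rotated 3]) (blast | (simp; fail))+
    have "r0 \<cdot> ?e = k" unfolding k by (simp add: reassoc[OF r0f])
    then have [simp]: "r0 \<boxplus> \<boxminus> (r0 \<cdot> (s \<cdot> g)) = k" by simp
    have kf: "f \<cdot> (k \<cdot> f) = f" "f \<cdot> (k \<cdot> s) = zmor C D B"
      using arg_cong[OF k, of "\<lambda>x. x \<cdot> f"] arg_cong[OF k, of "\<lambda>x. x \<cdot> s"] by simp_all
    have "k \<cdot> f = ident C A" "k \<cdot> s = zmor C D A"
      using arg_cong[OF kf(1), of "\<lambda>x. r0 \<cdot> x"] arg_cong[OF kf(2), of "\<lambda>x. r0 \<cdot> x"]
      by (simp_all add: r0f reassoc[OF r0f])
    moreover have "f \<cdot> k \<boxplus> s \<cdot> g = ident C B" unfolding k[symmetric] by simp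
    ultimately show ?thesis by (intro biproductI) simp_all
  qed
  then show thesis by (rule that)
qed

lemma inflation_retraction_biproduct:
  assumes t: "etriangle C A f B g D \<delta>" and r: "arr C r" "src C r = B" "tgt C r = A" "r \<cdot> f = ident C A"
  obtains s where "is_biproduct C A D B f s r g"
proof -
  have t': "etriangle (opp C) D g B f A \<delta>" using t by simp
  obtain s where "is_biproduct (opp C) D A B g r s f"
    by (rule extriangulated_category.deflation_section_biproduct[OF opp_extriangulated_category t', of r])
      (use r in auto)
  then show thesis using that[of s] biproduct_swap[of D A B s f g r] by simp
qed

section \<open>Direct summands and composites\<close>

text \<open>
  The direct sum with the split triangle \<open>0 \<rightarrow> M = M\<close>, where \<open>A\<close> itself serves as the direct sum
  of \<open>A\<close> and \<open>0\<close>.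
\<close>

lemma etriangle_add_summand:
  assumes t: "etriangle C A f B g D \<delta>" and b: "is_biproduct C B M P i j p q"
    and b': "is_biproduct C D M Q i' j' p' q'"
  shows "etriangle C A (i \<cdot> f) P (i' \<cdot> (g \<cdot> p) \<boxplus> j' \<cdot> q) Q (pull C A p' \<delta>)"
proof -
  note [simp] = etriangleD[OF t] biproductD[OF b] biproductD(1-19)[OF b']
  obtain N where N: "is_zero_object C N" using zero_object_exists by blast
  then have [simp]: "N \<in> Obj C" unfolding is_zero_object_def by blast
  note * = realize_sum[OF t split_triangle_zero_left[OF N]
      biproduct_swap[OF biproduct_zero_left[OF N]] b b']
  have "etriangle C A
     (map_sum C A (ident C A) (zmor C A N) P i j f (zmor C N M)) P
     (map_sum C P p q Q i' j' g (ident C M)) Q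
     (ext_sum C Q p' q' A (ident C A) (zmor C N A) \<delta> \<zero>\<^bsub>Ext C M N\<^esub>)"
    by (rule *) simp_all
  moreover have "map_sum C A (ident C A) (zmor C A N) P i j f (zmor C N M) = i \<cdot> f"
    unfolding map_sum_def by (simp add: madd_conv)
  moreover have "map_sum C P p q Q i' j' g (ident C M) = i' \<cdot> (g \<cdot> p) \<boxplus> j' \<cdot> q"
    unfolding map_sum_def by (simp add: madd_conv)
  moreover have "ext_sum C Q p' q' A (ident C A) (zmor C N A) \<delta> \<zero>\<^bsub>Ext C M N\<^esub> = pull C A p' \<delta>"
  proof -
    interpret G: abelian_group "Ext C Q A" by (rule Ext_abelian_group) simp_all
    have "pull C A p' \<delta> \<in> carrier (Ext C Q A)" by simp
    then show ?thesis unfolding ext_sum_def by (simp add: pull_def)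
  qed
  ultimately show ?thesis by simp
qed

lemma etriangle_add_summand_left:
  assumes t: "etriangle C X f Y g Z \<delta>" and b: "is_biproduct C Y M P i j p q"
    and b': "is_biproduct C X M R k l r s"
  shows "etriangle C R (i \<cdot> (f \<cdot> r) \<boxplus> j \<cdot> s) P (g \<cdot> p) Z (push C Z k \<delta>)"
proof -
  note [simp] = etriangleD[OF t] biproductD(1-19)[OF b] biproductD(1-19)[OF b']
  show ?thesis
    using extriangulated_category.etriangle_add_summand[OF opp_extriangulated_category, of Z g Y f X \<delta> M P p q i j R r s k l]
    t b b' by simp
qed

lemma inflationE:
  assumes "inflation C f" "arr C f" "src C f = X" "tgt C f = Y"
  obtains g Z \<delta> where "etriangle C X f Y g Z \<delta>"
  using assms etriangleD unfolding inflation_def by metis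

lemma deflationE:
  assumes "deflation C g" "arr C g" "src C g = Y" "tgt C g = Z"
  obtains X f \<delta> where "etriangle C X f Y g Z \<delta>"
  using assms etriangleD unfolding deflation_def by metis

lemma etriangle_inflation: "etriangle C X f Y g Z \<delta> \<Longrightarrow> inflation C f"
  unfolding inflation_def by blast

lemma etriangle_deflation: "etriangle C X f Y g Z \<delta> \<Longrightarrow> deflation C g"
  unfolding deflation_def by blast

lemma inflation_comp:
  assumes "inflation C f" "inflation C g" "arr C f" "arr C g" "src C g = tgt C f"
  shows "inflation C (g \<cdot> f)"
proof -
  obtain h Z \<delta> where t: "etriangle C (src C f) f (tgt C f) h Z \<delta>" using assms by (auto elim: inflationE)
  obtain h' Z' \<delta>' where t': "etriangle C (tgt C f) g (tgt C g) h' Z' \<delta>'" using assms by (auto elim: inflationE)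
  from ET4[OF t t'] show ?thesis unfolding inflation_def by blast
qed

lemma deflation_comp:
  assumes "deflation C f" "deflation C g" "arr C f" "arr C g" "src C g = tgt C f"
  shows "deflation C (g \<cdot> f)"
  using extriangulated_category.inflation_comp[OF opp_extriangulated_category, of g f] assms by simp

lemma inflation_iso_comp:
  assumes "inflation C f" "arr C f" "tgt C f = Y"
    and c: "arr C c" "src C c = Y" "tgt C c = Y'" "arr C c'" "src C c' = Y'" "tgt C c' = Y"
    "c' \<cdot> c = ident C Y" "c \<cdot> c' = ident C Y'"
  shows "inflation C (c \<cdot> f)"
proof -
  obtain g Z \<delta> where t: "etriangle C (src C f) f Y g Z \<delta>"
    using assms(1-3) by (auto elim: inflationE)
  show ?thesis using etriangle_iso_middle[OF t c] by (rule etriangle_inflation)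
qed

end

section \<open>Homotopy cartesian squares\<close>

text \<open>
  This says that the square formed by \<open>f : X \<rightarrow> Y\<close>, \<open>\<alpha> : X \<rightarrow> X'\<close>, \<open>b : Y \<rightarrow> E\<close> and \<open>s : X' \<rightarrow> E\<close> is homotopy cartesian,
  with the sign absorbed into \<open>s\<close>: the square anticommutes. In this form the notion is invariant
  under exchanging the two paths from \<open>X\<close> to \<open>E\<close> and under passing to the opposite category.
\<close>

definition mapping_cone :: "('o, 'm, 'e, 'z) extri_scheme \<Rightarrow>
    'o \<Rightarrow> 'm \<Rightarrow> 'o \<Rightarrow> 'm \<Rightarrow> 'o \<Rightarrow> 'm \<Rightarrow> 'm \<Rightarrow> 'o \<Rightarrow> 'e \<Rightarrow> bool" where
  "mapping_cone C X f Y \<alpha> X' b s E \<theta> \<longleftrightarrow>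
    \<guillemotleft>f : X \<rightarrow>\<^bsub>C\<^esub> Y\<guillemotright> \<and> \<guillemotleft>\<alpha> : X \<rightarrow>\<^bsub>C\<^esub> X'\<guillemotright> \<and> \<guillemotleft>b : Y \<rightarrow>\<^bsub>C\<^esub> E\<guillemotright> \<and> \<guillemotleft>s : X' \<rightarrow>\<^bsub>C\<^esub> E\<guillemotright> \<and>
    (\<forall>P i j p q. is_biproduct C Y X' P i j p q \<longrightarrow>
      etriangle C X (column C X P i j f \<alpha>) P (row C P E p q b s) E \<theta>)"

lemma opp_mapping_cone [simp]:
  "mapping_cone (opp C) E b Y s X' f \<alpha> X \<theta> \<longleftrightarrow> mapping_cone C X f Y \<alpha> X' b s E \<theta>"
  unfolding mapping_cone_def by auto

context extriangulated_category
begin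

lemma mapping_coneD:
  assumes "mapping_cone C X f Y \<alpha> X' b s E \<theta>"
  shows "X \<in> Obj C" "Y \<in> Obj C" "X' \<in> Obj C" "E \<in> Obj C" "arr C f" "src C f = X" "tgt C f = Y"
    "arr C \<alpha>" "src C \<alpha> = X" "tgt C \<alpha> = X'" "arr C b" "src C b = Y" "tgt C b = E"
    "arr C s" "src C s = X'" "tgt C s = E"
  using assms unfolding mapping_cone_def by (auto simp: morD)

lemma mapping_cone_etriangle:
  assumes "mapping_cone C X f Y \<alpha> X' b s E \<theta>" "is_biproduct C Y X' P i j p q"
  shows "etriangle C X (i \<cdot> f \<boxplus> j \<cdot> \<alpha>) P (b \<cdot> p \<boxplus> s \<cdot> q) E \<theta>"
proof -
  note [simp] = mapping_coneD[OF assms(1)]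
  have "etriangle C X (column C X P i j f \<alpha>) P (row C P E p q b s) E \<theta>"
    using assms unfolding mapping_cone_def by blast
  then show ?thesis by (simp add: column_conv[OF assms(2)] row_conv[OF assms(2)])
qed

text \<open>
  Any two direct sums of \<open>Y\<close> and \<open>X'\<close> are isomorphic compatibly with rows and columns, so one of them
  suffices.
\<close>

lemma mapping_coneI:
  assumes t: "etriangle C X (i \<cdot> f \<boxplus> j \<cdot> \<alpha>) P (b \<cdot> p \<boxplus> s \<cdot> q) E \<theta>"
    and bp: "is_biproduct C Y X' P i j p q"
    and ty: "arr C f" "src C f = X" "tgt C f = Y" "arr C \<alpha>" "src C \<alpha> = X" "tgt C \<alpha> = X'"
      "arr C b" "src C b = Y" "tgt C b = E" "arr C s" "src C s = X'" "tgt C s = E"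
  shows "mapping_cone C X f Y \<alpha> X' b s E \<theta>"
proof -
  note [simp] = ty biproductD[OF bp]
  have [simp]: "X \<in> Obj C" "E \<in> Obj C" using etriangleD[OF t] by blast+
  have "etriangle C X (column C X P' i' j' f \<alpha>) P' (row C P' E p' q' b s) E \<theta>"
    if bp': "is_biproduct C Y X' P' i' j' p' q'" for P' i' j' p' q'
  proof -
    note [simp] = biproductD[OF bp']
    let ?h = "i' \<cdot> p \<boxplus> j' \<cdot> q" and ?k = "i \<cdot> p' \<boxplus> j \<cdot> q'"
    have "etriangle C X (?h \<cdot> (i \<cdot> f \<boxplus> j \<cdot> \<alpha>)) P' ((b \<cdot> p \<boxplus> s \<cdot> q) \<cdot> ?k) E \<theta>"
      by (rule etriangle_iso_middle[OF t]) simp_all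
    then show ?thesis by (simp add: column_conv[OF bp'] row_conv[OF bp'])
  qed
  then show ?thesis unfolding mapping_cone_def mor_iff by simp
qed

lemma mapping_cone_comp:
  assumes "mapping_cone C X f Y \<alpha> X' b s E \<theta>"
  shows "s \<cdot> \<alpha> = \<boxminus> (b \<cdot> f)"
proof -
  note [simp] = mapping_coneD[OF assms]
  obtain P i j p q where bp: "is_biproduct C Y X' P i j p q" using biproduct_exists[of Y X'] by auto
  note [simp] = biproductD[OF bp]
  have "b \<cdot> f \<boxplus> s \<cdot> \<alpha> = zmor C X E"
    using etriangle_comp_zero[OF mapping_cone_etriangle[OF assms bp]] by simp
  then show ?thesis by (intro mneg_unique) simp_all
qed

lemma mapping_cone_swap:
  assumes "mapping_cone C X f Y \<alpha> X' b s E \<theta>"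
  shows "mapping_cone C X \<alpha> X' f Y s b E \<theta>"
proof -
  note [simp] = mapping_coneD[OF assms]
  obtain P i j p q where bp: "is_biproduct C Y X' P i j p q" using biproduct_exists[of Y X'] by auto
  note [simp] = biproductD[OF bp]
  have "etriangle C X (j \<cdot> \<alpha> \<boxplus> i \<cdot> f) P (s \<cdot> q \<boxplus> b \<cdot> p) E \<theta>"
    using mapping_cone_etriangle[OF assms bp] madd_comm[of "i \<cdot> f" "j \<cdot> \<alpha>"] madd_comm[of "b \<cdot> p" "s \<cdot> q"] by simp
  then show ?thesis by (rule mapping_coneI[OF _ biproduct_swap[OF bp]]) simp_all
qed

lemma mapping_cone_unique:
  assumes m: "mapping_cone C X f Y \<alpha> X' b s E \<theta>" and m': "mapping_cone C X f Y \<alpha> X' b' s' E' \<theta>'"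
  obtains \<phi> \<psi> where "arr C \<phi>" "src C \<phi> = E" "tgt C \<phi> = E'" "arr C \<psi>" "src C \<psi> = E'" "tgt C \<psi> = E"
    "\<psi> \<cdot> \<phi> = ident C E" "\<phi> \<cdot> \<psi> = ident C E'" "\<phi> \<cdot> b = b'" "\<phi> \<cdot> s = s'" "pull C X \<phi> \<theta>' = \<theta>"
proof -
  note [simp] = mapping_coneD[OF m] mapping_coneD[OF m']
  obtain P i j p q where bp: "is_biproduct C Y X' P i j p q" using biproduct_exists[of Y X'] by auto
  note [simp] = biproductD[OF bp]
  obtain \<phi> \<psi> where *: "arr C \<phi>" "src C \<phi> = E" "tgt C \<phi> = E'" "arr C \<psi>" "src C \<psi> = E'" "tgt C \<psi> = E"
    "\<psi> \<cdot> \<phi> = ident C E" "\<phi> \<cdot> \<psi> = ident C E'" and e: "\<phi> \<cdot> (b \<cdot> p \<boxplus> s \<cdot> q) = b' \<cdot> p \<boxplus> s' \<cdot> q"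
    and **: "pull C X \<phi> \<theta>' = \<theta>"
    by (rule cofiber_unique[OF mapping_cone_etriangle[OF m bp] mapping_cone_etriangle[OF m' bp]]) blast
  note [simp] = *
  have "(\<phi> \<cdot> (b \<cdot> p \<boxplus> s \<cdot> q)) \<cdot> i = b'" "(\<phi> \<cdot> (b \<cdot> p \<boxplus> s \<cdot> q)) \<cdot> j = s'" unfolding e by simp_all
  then have "\<phi> \<cdot> b = b'" "\<phi> \<cdot> s = s'" by simp_all
  then show thesis using that[of \<phi> \<psi>] * ** by simp
qed

lemma split_etriangle_shear:
  assumes bp: "is_biproduct C A B P i j p q" and f: "arr C f" "src C f = A" "tgt C f = B"
  shows "etriangle C A (i \<boxplus> j \<cdot> f) P (q \<boxplus> \<boxminus> (f \<cdot> p)) B \<zero>\<^bsub>Ext C B A\<^esub>"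
  using realize_zero[OF biproduct_shear[OF bp f]] .

text \<open>
  The map \<open>X \<rightarrow> Y \<oplus> X'\<close> with components \<open>f, \<alpha>\<close> is the composite of the split inflation
  \<open>X \<rightarrow> X \<oplus> X'\<close> with components \<open>1, \<alpha>\<close> and \<open>f \<oplus> 1\<close>. The octahedron on this composite has the mapping cone as one
  of its triangles, and as another one a realization of the push-out of \<open>\<delta>\<close> along \<open>(-\<alpha>, 1)(1, 0) = -\<alpha>\<close>.
  Changing the sign of its inflation makes this a realization of \<open>\<alpha>\<^sub>* \<delta>\<close>.
\<close>

lemma mapping_cone_exists:
  assumes t: "etriangle C X f Y g Z \<delta>" and a: "arr C \<alpha>" "src C \<alpha> = X" "tgt C \<alpha> = X'"
  obtains s E t b where "etriangle C X' s E t Z (push C Z \<alpha> \<delta>)"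
    "arr C b" "src C b = Y" "tgt C b = E" "b \<cdot> f = s \<cdot> \<alpha>" "t \<cdot> b = g"
    "mapping_cone C X f Y \<alpha> X' b (\<boxminus> s) E (pull C X t \<delta>)"
proof -
  note [simp] = etriangleD[OF t] a
  have [simp]: "X' \<in> Obj C" using arr_Obj(2)[OF a(1)] by simp
  obtain P i j p q where bp: "is_biproduct C Y X' P i j p q" using biproduct_exists[of Y X'] by auto
  obtain R k l r r' where br: "is_biproduct C X X' R k l r r'" using biproduct_exists[of X X'] by auto
  note [simp] = biproductD[OF bp] biproductD[OF br]
  let ?u = "i \<cdot> (f \<cdot> r) \<boxplus> j \<cdot> r'" and ?e = "r' \<boxplus> \<boxminus> (\<alpha> \<cdot> r)"
  obtain m h E \<theta> w t' \<eta> where T: "etriangle C X m P h E \<theta>" "etriangle C X' w E t' Z \<eta>"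
    and eq: "m = ?u \<cdot> (k \<boxplus> l \<cdot> \<alpha>)" "w \<cdot> ?e = h \<cdot> ?u" "g \<cdot> p = t' \<cdot> h"
      "push C Z ?e (push C Z k \<delta>) = \<eta>" "push C E (k \<boxplus> l \<cdot> \<alpha>) \<theta> = pull C R t' (push C Z k \<delta>)"
    using ET4[OF split_etriangle_shear[OF br a] etriangle_add_summand_left[OF t bp br]] by blast
  note [simp] = etriangleD(3-9)[OF T(1)] etriangleD(4-9)[OF T(2)]
  have [simp]: "\<theta> \<in> carrier (Ext C E X)" using etriangleD[OF T(1)] by simp
  have m: "m = i \<cdot> f \<boxplus> j \<cdot> \<alpha>" unfolding eq(1) by simp
  have wj: "w = h \<cdot> j"
    using arg_cong[OF eq(2), of "\<lambda>x. x \<cdot> l"] by simp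
  have h: "h = (h \<cdot> i) \<cdot> p \<boxplus> \<boxminus> (\<boxminus> w) \<cdot> q"
    using out_of_biproduct_decomp[OF bp, of h] unfolding wj by simp
  have bf: "(h \<cdot> i) \<cdot> f = \<boxminus> w \<cdot> \<alpha>"
    using arg_cong[OF eq(2), of "\<lambda>x. x \<cdot> k"] by simp
  have tb: "t' \<cdot> (h \<cdot> i) = g"
    using arg_cong[OF eq(3), of "\<lambda>x. x \<cdot> i"] by simp
  have eta: "\<eta> = push C Z (\<boxminus> \<alpha>) \<delta>" unfolding eq(4)[symmetric] by simp
  have theta: "\<theta> = pull C X t' \<delta>"
  proof -
    have "\<theta> = push C E r (push C E (k \<boxplus> l \<cdot> \<alpha>) \<theta>)" by simp
    also have "\<dots> = pull C X t' (push C Z r (push C Z k \<delta>))"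
      unfolding eq(5) by (rule push_pull) simp_all
    also have "\<dots> = pull C X t' \<delta>" by simp
    finally show ?thesis .
  qed
  have "etriangle C X' (w \<cdot> \<boxminus> ident C X') E (ident C Z \<cdot> t') Z (pull C X' (ident C Z) (push C Z (\<boxminus> ident C X') \<eta>))"
    by (rule etriangle_transport[OF T(2)]) simp_all
  then have 1: "etriangle C X' (\<boxminus> w) E t' Z (push C Z \<alpha> \<delta>)" by (simp add: eta)
  have "etriangle C X (i \<cdot> f \<boxplus> j \<cdot> \<alpha>) P ((h \<cdot> i) \<cdot> p \<boxplus> \<boxminus> (\<boxminus> w) \<cdot> q) E (pull C X t' \<delta>)"
    using T(1) unfolding m[symmetric] theta[symmetric] h[symmetric] .
  then have 2: "mapping_cone C X f Y \<alpha> X' (h \<cdot> i) (\<boxminus> (\<boxminus> w)) E (pull C X t' \<delta>)"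
    by (rule mapping_coneI[OF _ bp]) simp_all
  show thesis by (rule that[OF 1 _ _ _ bf tb 2]) simp_all
qed

text \<open>
  Let \<open>X \<rightarrow> X' \<rightarrow> W\<close> be a triangle on \<open>\<alpha>\<close>. The square constructed from this triangle and \<open>f\<close> has the same
  edges at \<open>X\<close>, and its edge starting at \<open>Y\<close> is an inflation, as part of a triangle \<open>Y \<rightarrow> E2 \<rightarrow> W\<close>. Mapping
  cones of the same pair of maps are isomorphic.
\<close>

lemma mapping_cone_inflation:
  assumes m: "mapping_cone C X f Y \<alpha> X' b s E \<theta>" and a: "inflation C \<alpha>"
  shows "inflation C b"
proof -
  note [simp] = mapping_coneD[OF m]
  obtain c W \<omega> where "etriangle C X \<alpha> X' c W \<omega>" using a by (auto elim: inflationE)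
  then obtain s2 E2 t2 b2 where t: "etriangle C Y s2 E2 t2 W (push C W f \<omega>)"
    and m2: "mapping_cone C X \<alpha> X' f Y b2 (\<boxminus> s2) E2 (pull C X t2 \<omega>)"
    by (rule mapping_cone_exists[of _ _ _ _ _ _ f Y]) (blast | (simp; fail))+
  note [simp] = etriangleD[OF t]
  obtain \<phi> \<psi> where p: "arr C \<phi>" "src C \<phi> = E2" "tgt C \<phi> = E" "arr C \<psi>" "src C \<psi> = E" "tgt C \<psi> = E2"
    "\<psi> \<cdot> \<phi> = ident C E2" "\<phi> \<cdot> \<psi> = ident C E" "\<phi> \<cdot> (\<boxminus> s2) = b"
    by (rule mapping_cone_unique[OF mapping_cone_swap[OF m2] m])
  note [simp] = p(1-8)
  have "inflation C (\<boxminus> \<phi> \<cdot> s2)"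
    by (rule inflation_iso_comp[OF etriangle_inflation[OF t], of _ _ _ "\<boxminus> \<psi>"]) simp_all
  then show ?thesis using p(9) by simp
qed

text \<open>
  ET4 for the composite \<open>h \<cdot> q\<close> exhibits \<open>m\<close> as a deflation \<open>q0\<close> after the cofiber of \<open>h \<cdot> q\<close>. As \<open>u\<close> is
  another cofiber of that inflation, \<open>q0\<close> agrees with \<open>f\<close> up to isomorphism, since \<open>u\<close> is split epi.
\<close>

lemma deflation_cancel_split:
  assumes t: "etriangle C E q F w D \<eta>" and t1: "etriangle C F h K m X \<theta>" and t2: "etriangle C E (h \<cdot> q) K u B \<epsilon>"
    and r: "arr C r" "src C r = B" "tgt C r = K" "u \<cdot> r = ident C B"
    and f: "arr C f" "src C f = B" "tgt C f = X" "m = f \<cdot> u"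
  shows "deflation C f"
proof -
  note [simp] = etriangleD[OF t] etriangleD[OF t1] etriangleD[OF t2] r f(1-3)
  obtain m' h0 F0 \<theta>0 w0 q0 \<eta>0 where T: "etriangle C E m' K h0 F0 \<theta>0" "etriangle C D w0 F0 q0 X \<eta>0"
    and eq: "m' = h \<cdot> q" "m = q0 \<cdot> h0"
    using ET4[OF t t1] by blast
  note [simp] = etriangleD[OF T(2)] etriangleD(7-9)[OF T(1)]
  obtain \<phi> \<psi> where p [simp]: "arr C \<phi>" "src C \<phi> = B" "tgt C \<phi> = F0" "arr C \<psi>" "src C \<psi> = F0" "tgt C \<psi> = B"
    "\<psi> \<cdot> \<phi> = ident C B" "\<phi> \<cdot> \<psi> = ident C F0" and e: "\<phi> \<cdot> u = h0"
    by (rule cofiber_unique[OF t2 T(1)[unfolded eq(1)]])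
  have "f = (f \<cdot> u) \<cdot> r" by simp
  also have "\<dots> = (q0 \<cdot> (\<phi> \<cdot> u)) \<cdot> r" unfolding f(4)[symmetric] eq(2) e ..
  also have "\<dots> = q0 \<cdot> \<phi>" by simp
  finally have "f = q0 \<cdot> \<phi>" .
  moreover have "etriangle C D (\<psi> \<cdot> w0) B (q0 \<cdot> \<phi>) X \<eta>0"
    by (rule etriangle_iso_middle[OF T(2)]) simp_all
  ultimately show ?thesis by (auto intro: etriangle_deflation)
qed

text \<open>
  Let \<open>N\<close> be the fibre of \<open>\<alpha>\<close>. The composite of \<open>1 \<oplus> \<alpha> : Y \<oplus> X \<rightarrow> Y \<oplus> X'\<close> with the deflation
  \<open>(b, s) : Y \<oplus> X' \<rightarrow> E\<close> is a deflation; as \<open>s \<alpha> = - b f\<close>, it equals \<open>b \<cdot> (1, -f)\<close>. By ET4 in the dual form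
  its fibre \<open>B\<close> is an extension of \<open>X\<close> by \<open>N\<close>, pulled back along \<open>\<alpha>\<close> from the class of \<open>\<alpha>\<close>, and so it
  splits. A suitable section \<open>X \<rightarrow> B\<close> is mapped to the fibre \<open>(f, 1)\<close> of the split epimorphism \<open>(1, -f)\<close>,
  which can therefore be cancelled.
\<close>

lemma mapping_cone_deflation:
  assumes m: "mapping_cone C X f Y \<alpha> X' b s E \<theta>" and a: "deflation C \<alpha>"
  shows "deflation C b"
proof -
  note [simp] = mapping_coneD[OF m]
  have sa: "s \<cdot> \<alpha> = \<boxminus> (b \<cdot> f)" by (rule mapping_cone_comp[OF m])
  note [simp] = sa reassoc[OF sa]
  obtain N n \<nu> where N: "etriangle C N n X \<alpha> X' \<nu>" using a by (auto elim: deflationE)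
  obtain P i j p q where bp: "is_biproduct C Y X' P i j p q" using biproduct_exists[of Y X'] by auto
  obtain Q i2 j2 p2 q2 where bq: "is_biproduct C Y X Q i2 j2 p2 q2" using biproduct_exists[of Y X] by auto
  note [simp] = etriangleD[OF N] biproductD[OF bp] biproductD[OF bq]
    etriangle_comp_zero[OF N] etriangle_comp_zero'[OF N]
  \<comment> \<open>\<open>?h\<close> is \<open>1 \<oplus> \<alpha> : Y \<oplus> X \<rightarrow> Y \<oplus> X'\<close>, a deflation with the same fibre \<open>N\<close> as \<open>\<alpha>\<close>.\<close>
  let ?w = "i \<cdot> f \<boxplus> j \<cdot> \<alpha>" and ?h = "j \<cdot> (\<alpha> \<cdot> q2) \<boxplus> i \<cdot> p2" and ?r = "b \<cdot> p \<boxplus> s \<cdot> q"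
  obtain f0 B g0 \<delta>0 u v \<epsilon> where T: "etriangle C N f0 B g0 X \<delta>0" "etriangle C B u Q v E \<epsilon>"
    and eq: "j2 \<cdot> n = u \<cdot> f0" "?w \<cdot> g0 = ?h \<cdot> u" "v = ?r \<cdot> ?h" "pull C N ?w (pull C N q \<nu>) = \<delta>0"
    using ET4_op[OF etriangle_add_summand[OF N biproduct_swap[OF bq] biproduct_swap[OF bp]]
        mapping_cone_etriangle[OF m bp]] by blast
  note [simp] = etriangleD[OF T(1)] etriangleD(4-10)[OF T(2)]
  have d0: "\<delta>0 = \<zero>\<^bsub>Ext C X N\<^esub>" unfolding eq(4)[symmetric] by (simp add: etriangle_pull_zero[OF N])
  have qu: "\<alpha> \<cdot> g0 = \<alpha> \<cdot> (q2 \<cdot> u)" and pu: "f \<cdot> g0 = p2 \<cdot> u"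
    using arg_cong[OF eq(2), of "\<lambda>x. q \<cdot> x"] arg_cong[OF eq(2), of "\<lambda>x. p \<cdot> x"] by simp_all
  obtain \<sigma>0 where s0 [simp]: "arr C \<sigma>0" "src C \<sigma>0 = X" "tgt C \<sigma>0 = B" and gs0: "ident C X = g0 \<cdot> \<sigma>0"
    by (rule lift_along_deflation[OF T(1), of "ident C X" X]) (blast | (simp add: d0; fail))+
  have gs0' [simp]: "g0 \<cdot> \<sigma>0 = ident C X" using gs0 by simp
  have "\<alpha> \<cdot> (q2 \<cdot> (u \<cdot> \<sigma>0)) = (\<alpha> \<cdot> g0) \<cdot> \<sigma>0" unfolding qu by simp
  then have aq [simp]: "\<alpha> \<cdot> (q2 \<cdot> (u \<cdot> \<sigma>0)) = \<alpha>" by simp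
  \<comment> \<open>The section has to be corrected by a map into \<open>N\<close> to make its component \<open>X \<rightarrow> X\<close> the identity.\<close>
  obtain k where k [simp]: "arr C k" "src C k = X" "tgt C k = N"
    and nk: "q2 \<cdot> (u \<cdot> \<sigma>0) \<boxplus> \<boxminus> ident C X = n \<cdot> k"
    by (rule weak_kernel[OF N, of "q2 \<cdot> (u \<cdot> \<sigma>0) \<boxplus> \<boxminus> ident C X" X]) (blast | (simp; fail))+
  define \<sigma> where "\<sigma> = \<sigma>0 \<boxplus> \<boxminus> (f0 \<cdot> k)"
  have s [simp]: "arr C \<sigma>" "src C \<sigma> = X" "tgt C \<sigma> = B" unfolding \<sigma>_def by simp_all
  have gs [simp]: "g0 \<cdot> \<sigma> = ident C X"
    unfolding \<sigma>_def by (simp add: etriangle_comp_zero'[OF T(1)])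
  obtain \<rho> where bB: "is_biproduct C N X B f0 \<sigma> \<rho> g0"
    by (rule deflation_section_biproduct[OF T(1) s gs])
  have qf: "q2 \<cdot> (u \<cdot> f0) = n" unfolding eq(1)[symmetric] by simp
  have "q2 \<cdot> (u \<cdot> \<sigma>) = q2 \<cdot> (u \<cdot> \<sigma>0) \<boxplus> \<boxminus> (n \<cdot> k)"
    unfolding \<sigma>_def qf[symmetric] by simp
  also have "\<dots> = ident C X" unfolding nk[symmetric] by simp
  finally have qs: "q2 \<cdot> (u \<cdot> \<sigma>) = ident C X" .
  have "p2 \<cdot> (u \<cdot> \<sigma>) = (f \<cdot> g0) \<cdot> \<sigma>" unfolding pu by simp
  then have ps: "p2 \<cdot> (u \<cdot> \<sigma>) = f" by simp
  have us: "u \<cdot> \<sigma> = j2 \<boxplus> i2 \<cdot> f"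
    by (rule into_biproduct_eqI[OF bq]) (simp_all add: qs ps)
  show ?thesis
  proof (rule deflation_cancel_split)
    show "etriangle C X \<sigma> B \<rho> N \<zero>\<^bsub>Ext C N X\<^esub>"
      using realize_zero[OF biproduct_swap[OF bB]] .
    show "etriangle C B u Q v E \<epsilon>" by (rule T(2))
    show "etriangle C X (u \<cdot> \<sigma>) Q (p2 \<boxplus> \<boxminus> (f \<cdot> q2)) Y \<zero>\<^bsub>Ext C Y X\<^esub>"
      unfolding us by (rule split_etriangle_shear[OF biproduct_swap[OF bq]]) simp_all
    show "(p2 \<boxplus> \<boxminus> (f \<cdot> q2)) \<cdot> i2 = ident C Y" by simp
    show "v = b \<cdot> (p2 \<boxplus> \<boxminus> (f \<cdot> q2))" unfolding eq(3) by (simp add: madd_ac)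
  qed simp_all
qed

end

section \<open>Factorizations of homotopic morphisms\<close>

text \<open>
  The middle map of the homotopic morphism is \<open>b2 \<cdot> b1\<close>; it is not a separate parameter. In this
  form each condition is self-dual or dual to another one.
\<close>

definition homotopy_factorization where
  "homotopy_factorization C X f Y g Z \<delta> X' f' Y' g' Z' \<delta>' \<alpha> \<gamma> s E t \<eta> b1 b2 \<longleftrightarrow>
    etriangle C X f Y g Z \<delta> \<and> etriangle C X' f' Y' g' Z' \<delta>' \<and> etriangle C X' s E t Z \<eta> \<and>
    \<guillemotleft>\<alpha> : X \<rightarrow>\<^bsub>C\<^esub> X'\<guillemotright> \<and> \<guillemotleft>\<gamma> : Z \<rightarrow>\<^bsub>C\<^esub> Z'\<guillemotright> \<and> \<guillemotleft>b1 : Y \<rightarrow>\<^bsub>C\<^esub> E\<guillemotright> \<and> \<guillemotleft>b2 : E \<rightarrow>\<^bsub>C\<^esub> Y'\<guillemotright> \<and>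
    b1 \<cdot>\<^bsub>C\<^esub> f = s \<cdot>\<^bsub>C\<^esub> \<alpha> \<and> t \<cdot>\<^bsub>C\<^esub> b1 = g \<and> b2 \<cdot>\<^bsub>C\<^esub> s = f' \<and> \<gamma> \<cdot>\<^bsub>C\<^esub> t = g' \<cdot>\<^bsub>C\<^esub> b2 \<and>
    push C Z \<alpha> \<delta> = \<eta> \<and> pull C X' \<gamma> \<delta>' = \<eta> \<and>
    mapping_cone C X f Y \<alpha> X' b1 (\<boxminus>\<^bsub>C\<^esub> s) E (pull C X t \<delta>) \<and>
    mapping_cone C E (\<boxminus>\<^bsub>C\<^esub> t) Z b2 Y' \<gamma> g' Z' (push C Z' s \<delta>')"

context extriangulated_category
begin

lemma homotopy_factorization_opp:
  assumes "homotopy_factorization C X f Y g Z \<delta> X' f' Y' g' Z' \<delta>' \<alpha> \<gamma> s E t \<eta> b1 b2"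
  shows "homotopy_factorization (opp C) Z' g' Y' f' X' \<delta>' Z g Y f X \<delta> \<gamma> \<alpha> t E s \<eta> b2 b1"
  using assms mapping_cone_swap unfolding homotopy_factorization_def
  unfolding opp_mapping_cone opp_simps opp_etriangle opp_mor opp_madd by metis

lemma homotopy_factorization_homotopic:
  assumes "homotopy_factorization C X f Y g Z \<delta> X' f' Y' g' Z' \<delta>' \<alpha> \<gamma> s E t \<eta> b1 b2"
  shows "homotopic C (X, f, Y, g, Z, \<delta>) (X', f', Y', g', Z', \<delta>') (\<alpha>, b2 \<cdot> b1, \<gamma>)"
proof -
  have T: "etriangle C X f Y g Z \<delta>" "etriangle C X' f' Y' g' Z' \<delta>'" "etriangle C X' s E t Z \<eta>"
    and m: "\<guillemotleft>\<alpha> : X \<rightarrow> X'\<guillemotright>" "\<guillemotleft>\<gamma> : Z \<rightarrow> Z'\<guillemotright>" "\<guillemotleft>b1 : Y \<rightarrow> E\<guillemotright>" "\<guillemotleft>b2 : E \<rightarrow> Y'\<guillemotright>"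
    and eq: "b1 \<cdot> f = s \<cdot> \<alpha>" "t \<cdot> b1 = g" "b2 \<cdot> s = f'" "\<gamma> \<cdot> t = g' \<cdot> b2"
    and ext: "push C Z \<alpha> \<delta> = \<eta>" "pull C X' \<gamma> \<delta>' = \<eta>"
    and cones: "mapping_cone C X f Y \<alpha> X' b1 (\<boxminus> s) E (pull C X t \<delta>)"
      "mapping_cone C E (\<boxminus> t) Z b2 Y' \<gamma> g' Z' (push C Z' s \<delta>')"
    using assms unfolding homotopy_factorization_def by blast+
  note [simp] = etriangleD[OF T(1)] etriangleD[OF T(2)] etriangleD[OF T(3)]
    morD[OF m(1)] morD[OF m(2)] morD[OF m(3)] morD[OF m(4)]
  have hom: "\<alpha> \<in> Hom C X X'" "\<gamma> \<in> Hom C Z Z'" "b1 \<in> Hom C Y E" "b2 \<in> Hom C E Y'" "b2 \<cdot> b1 \<in> Hom C Y Y'"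
    "ident C Z \<in> Hom C Z Z" "ident C X' \<in> Hom C X' X'"
    by (simp_all add: Hom_iff)
  have 1: "(b2 \<cdot> b1) \<cdot> f = f' \<cdot> \<alpha>"
  proof -
    have "(b2 \<cdot> b1) \<cdot> f = (b2 \<cdot> s) \<cdot> \<alpha>" by (simp add: eq(1))
    then show ?thesis unfolding eq(3) .
  qed
  have 2: "g' \<cdot> (b2 \<cdot> b1) = \<gamma> \<cdot> g"
  proof -
    have "g' \<cdot> (b2 \<cdot> b1) = (\<gamma> \<cdot> t) \<cdot> b1" by (simp add: eq(4))
    also have "\<dots> = \<gamma> \<cdot> g" by (simp add: eq(2))
    finally show ?thesis .
  qed
  have neg: "\<ominus>\<^bsub>hom_group C X' E\<^esub> s = \<boxminus> s" "\<ominus>\<^bsub>hom_group C E Z\<^esub> t = \<boxminus> t" by (simp_all add: mneg_conv)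
  have 3: "etriangle_morphism C (X, f, Y, g, Z, \<delta>) (X', f', Y', g', Z', \<delta>') (\<alpha>, b2 \<cdot> b1, \<gamma>)"
    unfolding etriangle_morphism.simps using T hom 1 2 ext by simp
  have 4: "etriangle_morphism C (X, f, Y, g, Z, \<delta>) (X', s, E, t, Z, \<eta>) (\<alpha>, b1, ident C Z)"
    unfolding etriangle_morphism.simps using T hom eq ext by simp
  have 5: "etriangle_morphism C (X', s, E, t, Z, \<eta>) (X', f', Y', g', Z', \<delta>') (ident C X', b2, \<gamma>)"
    unfolding etriangle_morphism.simps using T hom eq ext by simp
  have 6: "\<forall>P i j p q. is_biproduct C Y X' P i j p q \<longrightarrow>
      etriangle C X (column C X P i j f \<alpha>) P (row C P E p q b1 (\<ominus>\<^bsub>hom_group C X' E\<^esub> s))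
        E (pull C X t \<delta>)"
    unfolding neg using cones(1) unfolding mapping_cone_def by blast
  have 7: "\<forall>P i j p q. is_biproduct C Z Y' P i j p q \<longrightarrow>
      etriangle C E (column C E P i j (\<ominus>\<^bsub>hom_group C E Z\<^esub> t) b2) P (row C P Z' p q \<gamma> g')
        Z' (push C Z' s \<delta>')"
    unfolding neg using cones(2) unfolding mapping_cone_def by blast
  show ?thesis
    unfolding homotopic.simps
    by (rule conjI[OF 3], rule exI[of _ s], rule exI[of _ E], rule exI[of _ t], rule exI[of _ \<eta>],
      rule exI[of _ b1], rule exI[of _ b2], intro conjI) (rule T(3) hom refl 4 5 6 7)+
qed

text \<open>
  In the opposite category this is the square on \<open>g\<close> and \<open>\<gamma>\<close>, up to exchanging the two paths.
\<close>

lemma mapping_cone_exists_dual: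
  assumes t: "etriangle C X f Y g Z \<delta>" and c: "arr C \<gamma>" "src C \<gamma> = Z'" "tgt C \<gamma> = Z"
  obtains s E t b where "etriangle C X s E t Z' (pull C X \<gamma> \<delta>)"
    "arr C b" "src C b = E" "tgt C b = Y" "\<gamma> \<cdot> t = g \<cdot> b" "b \<cdot> s = f"
    "mapping_cone C E (\<boxminus> t) Z' b Y \<gamma> g Z (push C Z s \<delta>)"
proof -
  have t': "etriangle (opp C) Z g Y f X \<delta>" using t by simp
  have c': "arr (opp C) \<gamma>" "src (opp C) \<gamma> = Z" "tgt (opp C) \<gamma> = Z'" using c by simp_all
  obtain s E t b where "etriangle (opp C) Z' s E t X (push (opp C) X \<gamma> \<delta>)"
    "arr (opp C) b" "src (opp C) b = Y" "tgt (opp C) b = E" "b \<cdot>\<^bsub>opp C\<^esub> g = s \<cdot>\<^bsub>opp C\<^esub> \<gamma>" "t \<cdot>\<^bsub>opp C\<^esub> b = f"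
    "mapping_cone (opp C) Z g Y \<gamma> Z' b (\<boxminus>\<^bsub>opp C\<^esub> s) E (pull (opp C) Z t \<delta>)"
    by (rule extriangulated_category.mapping_cone_exists[OF opp_extriangulated_category t' c'])
  then show thesis using that[of t E s b] mapping_cone_swap[of E b Y "\<boxminus> s" Z' g \<gamma> Z] by simp
qed

lemma mapping_cone_iso_source:
  assumes m: "mapping_cone C X f Y \<alpha> X' b s E \<theta>"
    and h: "arr C h" "src C h = W" "tgt C h = X" "arr C k" "src C k = X" "tgt C k = W"
      "k \<cdot> h = ident C W" "h \<cdot> k = ident C X"
  shows "mapping_cone C W (f \<cdot> h) Y (\<alpha> \<cdot> h) X' b s E (push C E k \<theta>)"
proof -
  note [simp] = mapping_coneD[OF m] h
  obtain P i j p q where bp: "is_biproduct C Y X' P i j p q" using biproduct_exists[of Y X'] by auto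
  note [simp] = biproductD[OF bp]
  have [simp]: "W \<in> Obj C" using arr_Obj(1)[OF h(1)] by simp
  note T = mapping_cone_etriangle[OF m bp]
  have [simp]: "\<theta> \<in> carrier (Ext C E X)" using etriangleD[OF T] by simp
  have "etriangle C W ((i \<cdot> f \<boxplus> j \<cdot> \<alpha>) \<cdot> h) P (ident C E \<cdot> (b \<cdot> p \<boxplus> s \<cdot> q)) E (pull C W (ident C E) (push C E k \<theta>))"
    by (rule etriangle_transport[OF T, of k W h]) simp_all
  then show ?thesis by (intro mapping_coneI[OF _ bp]) simp_all
qed

text \<open>
  Let \<open>F\<close> be the mapping cone of \<open>f : X \<rightarrow> Y\<close> and \<open>s : X \<rightarrow> E\<close>; it lies in a triangle \<open>E \<rightarrow> F \<rightarrow> W\<close>. As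
  \<open>f\<close> equals \<open>h \<cdot> s\<close>, an automorphism of \<open>E \<oplus> Y\<close> turns the pair \<open>(s, f)\<close> into \<open>(s, 0)\<close>, whose cofiber is \<open>Z \<oplus> Y\<close>.
  Hence \<open>F \<cong> Z \<oplus> Y\<close>, and \<open>\<gamma>\<close> is the component \<open>Z \<rightarrow> W\<close> of the deflation \<open>F \<rightarrow> W\<close>.
\<close>

lemma mapping_cone_of_factored_inflation:
  assumes t: "etriangle C X s E t Z \<eta>" and t': "etriangle C X f Y g W \<delta>"
    and h: "arr C h" "src C h = E" "tgt C h = Y" "h \<cdot> s = f"
  obtains \<gamma> where "arr C \<gamma>" "src C \<gamma> = Z" "tgt C \<gamma> = W" "\<gamma> \<cdot> t = g \<cdot> h" "pull C X \<gamma> \<delta> = \<eta>"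
    "mapping_cone C E (\<boxminus> t) Z h Y \<gamma> g W (push C W s \<delta>)"
proof -
  note [simp] = etriangleD[OF t] etriangleD[OF t'] h
  obtain s1 F t1 b1 where T1: "etriangle C E s1 F t1 W (push C W s \<delta>)"
    and b1: "arr C b1" "src C b1 = Y" "tgt C b1 = F" "t1 \<cdot> b1 = g"
    and m1: "mapping_cone C X f Y s E b1 (\<boxminus> s1) F (pull C X t1 \<delta>)"
    by (rule mapping_cone_exists[OF t', of s E]) (blast | (simp; fail))+
  obtain P i j p q where bp: "is_biproduct C E Y P i j p q" using biproduct_exists[of E Y] by auto
  obtain M a b c d where bm: "is_biproduct C Z Y M a b c d" using biproduct_exists[of Z Y] by auto
  note [simp] = etriangleD(2-9)[OF T1] b1 biproductD[OF bp] biproductD[OF bm]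
  have "etriangle C X ((i \<boxplus> j \<cdot> h) \<cdot> s) P (a \<cdot> (t \<cdot> p) \<boxplus> b \<cdot> (q \<boxplus> \<boxminus> (h \<cdot> p))) M (pull C X c \<eta>)"
    by (rule etriangle_add_summand[OF t biproduct_shear[OF bp h(1-3)] bm])
  moreover have "a \<cdot> (t \<cdot> p) \<boxplus> b \<cdot> (q \<boxplus> \<boxminus> (h \<cdot> p)) = (a \<cdot> t \<boxplus> \<boxminus> (b \<cdot> h)) \<cdot> p \<boxplus> b \<cdot> q"
    by (simp add: madd_ac)
  ultimately have "etriangle C X (i \<cdot> s \<boxplus> j \<cdot> f) P ((a \<cdot> t \<boxplus> \<boxminus> (b \<cdot> h)) \<cdot> p \<boxplus> b \<cdot> q) M (pull C X c \<eta>)"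
    by simp
  then have m2: "mapping_cone C X s E f Y (a \<cdot> t \<boxplus> \<boxminus> (b \<cdot> h)) b M (pull C X c \<eta>)"
    by (rule mapping_coneI[OF _ bp]) simp_all
  obtain \<phi> \<psi> where p [simp]: "arr C \<phi>" "src C \<phi> = F" "tgt C \<phi> = M" "arr C \<psi>" "src C \<psi> = M" "tgt C \<psi> = F"
    "\<psi> \<cdot> \<phi> = ident C F" "\<phi> \<cdot> \<psi> = ident C M"
    and e: "\<phi> \<cdot> \<boxminus> s1 = a \<cdot> t \<boxplus> \<boxminus> (b \<cdot> h)" "\<phi> \<cdot> b1 = b" and pp: "pull C X \<phi> (pull C X c \<eta>) = pull C X t1 \<delta>"
    by (rule mapping_cone_unique[OF mapping_cone_swap[OF m1] m2])
  let ?c = "t1 \<cdot> (\<psi> \<cdot> a)"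
  have T2: "etriangle C E (\<phi> \<cdot> s1) M (t1 \<cdot> \<psi>) W (push C W s \<delta>)"
    by (rule etriangle_iso_middle[OF T1]) simp_all
  have "\<phi> \<cdot> s1 = \<boxminus> (\<phi> \<cdot> \<boxminus> s1)" by simp
  also have "\<dots> = a \<cdot> \<boxminus> t \<boxplus> b \<cdot> h" unfolding e(1) by simp
  finally have e1: "\<phi> \<cdot> s1 = a \<cdot> \<boxminus> t \<boxplus> b \<cdot> h" .
  have "(t1 \<cdot> \<psi>) \<cdot> b = g" unfolding e(2)[symmetric] by (simp add: reassoc[OF p(7)])
  then have e2: "t1 \<cdot> \<psi> = ?c \<cdot> c \<boxplus> g \<cdot> d"
    using out_of_biproduct_decomp[OF bm, of "t1 \<cdot> \<psi>"] by simp
  have m: "mapping_cone C E (\<boxminus> t) Z h Y ?c g W (push C W s \<delta>)"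
    by (rule mapping_coneI[OF T2[unfolded e1 e2] bm]) simp_all
  have ct: "?c \<cdot> t = g \<cdot> h"
  proof -
    have "\<boxminus> (g \<cdot> h) = \<boxminus> (?c \<cdot> t)" using mapping_cone_comp[OF m] by simp
    then have "\<boxminus> (\<boxminus> (g \<cdot> h)) = \<boxminus> (\<boxminus> (?c \<cdot> t))" by (rule arg_cong)
    then show ?thesis by simp
  qed
  have "pull C X ?c \<delta> = pull C X a (pull C X \<psi> (pull C X t1 \<delta>))" by simp
  also have "\<dots> = \<eta>" unfolding pp[symmetric] by (simp add: reassoc[OF p(8)])
  finally have "pull C X ?c \<delta> = \<eta>" .
  then show thesis using that[of ?c] ct m by simp
qed

text \<open>
  Since \<open>\<beta> f = f' \<alpha>\<close>, the map \<open>(\<beta>, -f') : Y \<oplus> X' \<rightarrow> Y'\<close> factors through the mapping cone \<open>E\<close>, which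
  yields \<open>b2\<close> with \<open>b2 \<cdot> b1 = \<beta>\<close> and \<open>b2 \<cdot> s = f'\<close>.
\<close>

lemma homotopy_factorization_right:
  assumes t: "etriangle C X f Y g Z \<delta>" and t': "etriangle C X' f' Y' g' Z' \<delta>'"
    and a: "arr C \<alpha>" "src C \<alpha> = X" "tgt C \<alpha> = X'" and b: "arr C \<beta>" "src C \<beta> = Y" "tgt C \<beta> = Y'"
    and c: "\<beta> \<cdot> f = f' \<cdot> \<alpha>"
  obtains \<gamma> s E t \<eta> b1 b2 where
    "homotopy_factorization C X f Y g Z \<delta> X' f' Y' g' Z' \<delta>' \<alpha> \<gamma> s E t \<eta> b1 b2" "\<beta> = b2 \<cdot> b1"
proof -
  note [simp] = etriangleD[OF t] etriangleD[OF t'] a b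
  obtain s E t b1 where T: "etriangle C X' s E t Z (push C Z \<alpha> \<delta>)"
    and b1: "arr C b1" "src C b1 = Y" "tgt C b1 = E" "b1 \<cdot> f = s \<cdot> \<alpha>" "t \<cdot> b1 = g"
    and m: "mapping_cone C X f Y \<alpha> X' b1 (\<boxminus> s) E (pull C X t \<delta>)"
    by (rule mapping_cone_exists[OF t a])
  obtain P i j p q where bp: "is_biproduct C Y X' P i j p q" using biproduct_exists[of Y X'] by auto
  note [simp] = etriangleD[OF T] b1(1-3) biproductD[OF bp]
  obtain b2 where b2: "arr C b2" "src C b2 = E" "tgt C b2 = Y'"
    and fac: "\<beta> \<cdot> p \<boxplus> \<boxminus> (f' \<cdot> q) = b2 \<cdot> (b1 \<cdot> p \<boxplus> \<boxminus> s \<cdot> q)"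
    by (rule weak_cokernel[OF mapping_cone_etriangle[OF m bp], of "\<beta> \<cdot> p \<boxplus> \<boxminus> (f' \<cdot> q)" Y'])
      (blast | (simp add: c; fail))+
  note [simp] = b2
  have bb: "\<beta> = b2 \<cdot> b1" using arg_cong[OF fac, of "\<lambda>x. x \<cdot> i"] by simp
  have "\<boxminus> f' = \<boxminus> (b2 \<cdot> s)" using arg_cong[OF fac, of "\<lambda>x. x \<cdot> j"] by simp
  then have "\<boxminus> (\<boxminus> f') = \<boxminus> (\<boxminus> (b2 \<cdot> s))" by (rule arg_cong)
  then have bs: "b2 \<cdot> s = f'" by simp
  obtain \<gamma> where g: "arr C \<gamma>" "src C \<gamma> = Z" "tgt C \<gamma> = Z'" "\<gamma> \<cdot> t = g' \<cdot> b2" "pull C X' \<gamma> \<delta>' = push C Z \<alpha> \<delta>"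
    "mapping_cone C E (\<boxminus> t) Z b2 Y' \<gamma> g' Z' (push C Z' s \<delta>')"
    by (rule mapping_cone_of_factored_inflation[OF T t' b2 bs])
  have "homotopy_factorization C X f Y g Z \<delta> X' f' Y' g' Z' \<delta>' \<alpha> \<gamma> s E t (push C Z \<alpha> \<delta>) b1 b2"
    unfolding homotopy_factorization_def mor_iff using t t' a T b1 b2 m bs g by simp
  then show thesis using that bb by blast
qed

lemma homotopy_factorization_left:
  assumes t: "etriangle C X f Y g Z \<delta>" and t': "etriangle C X' f' Y' g' Z' \<delta>'"
    and a: "arr C \<gamma>" "src C \<gamma> = Z" "tgt C \<gamma> = Z'" and b: "arr C \<beta>" "src C \<beta> = Y" "tgt C \<beta> = Y'"
    and c: "g' \<cdot> \<beta> = \<gamma> \<cdot> g"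
  obtains \<alpha> s E t \<eta> b1 b2 where
    "homotopy_factorization C X f Y g Z \<delta> X' f' Y' g' Z' \<delta>' \<alpha> \<gamma> s E t \<eta> b1 b2" "\<beta> = b2 \<cdot> b1"
proof -
  have o: "etriangle (opp C) Z' g' Y' f' X' \<delta>'" "etriangle (opp C) Z g Y f X \<delta>"
    "arr (opp C) \<gamma>" "src (opp C) \<gamma> = Z'" "tgt (opp C) \<gamma> = Z"
    "arr (opp C) \<beta>" "src (opp C) \<beta> = Y'" "tgt (opp C) \<beta> = Y" "\<beta> \<cdot>\<^bsub>opp C\<^esub> g' = g \<cdot>\<^bsub>opp C\<^esub> \<gamma>"
    using assms by simp_all
  obtain \<alpha> s E t \<eta> b1 b2 where
    h: "homotopy_factorization (opp C) Z' g' Y' f' X' \<delta>' Z g Y f X \<delta> \<gamma> \<alpha> s E t \<eta> b1 b2" "\<beta> = b2 \<cdot>\<^bsub>opp C\<^esub> b1"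
    by (rule extriangulated_category.homotopy_factorization_right[OF opp_extriangulated_category o])
  from extriangulated_category.homotopy_factorization_opp[OF opp_extriangulated_category h(1)] h(2)
  show thesis using that[of \<alpha> t E s \<eta> b2 b1] by (simp add: opp_opp)
qed

text \<open>
  The first square comes from a realization of \<open>\<alpha>\<^sub>* \<delta>\<close>, the second from one of \<open>\<gamma>\<^sup>* \<delta>'\<close>. These
  extensions agree, so the two realizations are isomorphic and the squares can be glued.
\<close>

lemma homotopy_factorization_middle:
  assumes t: "etriangle C X f Y g Z \<delta>" and t': "etriangle C X' f' Y' g' Z' \<delta>'"
    and a: "arr C \<alpha>" "src C \<alpha> = X" "tgt C \<alpha> = X'" and c: "arr C \<gamma>" "src C \<gamma> = Z" "tgt C \<gamma> = Z'"
    and e: "push C Z \<alpha> \<delta> = pull C X' \<gamma> \<delta>'"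
  obtains s E t \<eta> b1 b2 where
    "homotopy_factorization C X f Y g Z \<delta> X' f' Y' g' Z' \<delta>' \<alpha> \<gamma> s E t \<eta> b1 b2"
proof -
  note [simp] = etriangleD[OF t] etriangleD[OF t'] a c
  obtain s E t b1 where T: "etriangle C X' s E t Z (push C Z \<alpha> \<delta>)"
    and b1: "arr C b1" "src C b1 = Y" "tgt C b1 = E" "b1 \<cdot> f = s \<cdot> \<alpha>" "t \<cdot> b1 = g"
    and m: "mapping_cone C X f Y \<alpha> X' b1 (\<boxminus> s) E (pull C X t \<delta>)"
    by (rule mapping_cone_exists[OF t a])
  obtain s2 E2 t2 b2 where T2: "etriangle C X' s2 E2 t2 Z (pull C X' \<gamma> \<delta>')"
    and b2: "arr C b2" "src C b2 = E2" "tgt C b2 = Y'" "\<gamma> \<cdot> t2 = g' \<cdot> b2" "b2 \<cdot> s2 = f'"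
    and m2: "mapping_cone C E2 (\<boxminus> t2) Z b2 Y' \<gamma> g' Z' (push C Z' s2 \<delta>')"
    by (rule mapping_cone_exists_dual[OF t' c])
  note [simp] = etriangleD[OF T] etriangleD[OF T2] b1(1-3) b2(1-3)
  have T2': "etriangle C X' s2 E2 t2 Z (push C Z \<alpha> \<delta>)" using T2 unfolding e .
  obtain h where h [simp]: "arr C h" "src C h = E" "tgt C h = E2" and h': "h \<cdot> s = s2 \<cdot> ident C X'" "t2 \<cdot> h = ident C Z \<cdot> t"
    by (rule realize_morphismE[OF T T2', of "ident C X'" "ident C Z"]) (blast | (simp; fail))+
  obtain k where k [simp]: "arr C k" "src C k = E2" "tgt C k = E" "k \<cdot> h = ident C E" "h \<cdot> k = ident C E2"
    by (rule five_middle[OF T T2', of "ident C X'" "ident C X'" "ident C Z" "ident C Z" h])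
      (blast | (simp add: h'; fail))+
  have hs: "h \<cdot> s = s2" and th: "t2 \<cdot> h = t" using h' by simp_all
  have ks: "k \<cdot> s2 = s" unfolding hs[symmetric] by (simp add: reassoc[OF k(4)])
  have "mapping_cone C E (\<boxminus> t2 \<cdot> h) Z (b2 \<cdot> h) Y' \<gamma> g' Z' (push C Z' k (push C Z' s2 \<delta>'))"
    by (rule mapping_cone_iso_source[OF m2]) simp_all
  then have m3: "mapping_cone C E (\<boxminus> t) Z (b2 \<cdot> h) Y' \<gamma> g' Z' (push C Z' s \<delta>')"
    by (simp add: th ks)
  have e1: "(b2 \<cdot> h) \<cdot> s = f'" by (simp add: hs b2(5))
  have e2: "\<gamma> \<cdot> t = g' \<cdot> (b2 \<cdot> h)"
  proof -
    have "\<gamma> \<cdot> t = (\<gamma> \<cdot> t2) \<cdot> h" unfolding th[symmetric] by simp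
    also have "\<dots> = g' \<cdot> (b2 \<cdot> h)" unfolding b2(4) by simp
    finally show ?thesis .
  qed
  have "homotopy_factorization C X f Y g Z \<delta> X' f' Y' g' Z' \<delta>' \<alpha> \<gamma> s E t (push C Z \<alpha> \<delta>) b1 (b2 \<cdot> h)"
    unfolding homotopy_factorization_def mor_iff using t t' a c T b1 m m3 e1 e2 e by simp
  then show thesis by (rule that)
qed

text \<open>
  The edge \<open>b1\<close> lies opposite to \<open>\<alpha>\<close> in the first square, and \<open>\<gamma>\<close> lies opposite to \<open>b2\<close> in the second.
\<close>

lemma homotopy_factorization_first:
  assumes "homotopy_factorization C X f Y g Z \<delta> X' f' Y' g' Z' \<delta>' \<alpha> \<gamma> s E t \<eta> b1 b2"
  shows "inflation C \<alpha> \<Longrightarrow> inflation C b1" "deflation C \<alpha> \<Longrightarrow> deflation C b1"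
    "deflation C b2 \<Longrightarrow> deflation C \<gamma>"
  using assms mapping_cone_inflation mapping_cone_deflation unfolding homotopy_factorization_def by blast+

lemma homotopy_factorization_second:
  assumes "homotopy_factorization C X f Y g Z \<delta> X' f' Y' g' Z' \<delta>' \<alpha> \<gamma> s E t \<eta> b1 b2"
  shows "inflation C \<gamma> \<Longrightarrow> inflation C b2" "deflation C \<gamma> \<Longrightarrow> deflation C b2"
  using extriangulated_category.homotopy_factorization_first(1,2)[OF opp_extriangulated_category
    homotopy_factorization_opp[OF assms]] by simp_all

section \<open>Cancellation of factors\<close>

text \<open>
  Put \<open>\<beta> = b2 \<cdot> b1\<close>, with fibre \<open>K\<close>, and let \<open>W\<close> be the cofiber of \<open>b1\<close>. The octahedron on \<open>K \<rightarrow> Y \<rightarrow> E\<close>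
  gives a deflation \<open>h : E \<rightarrow> F\<close>, where \<open>F\<close> is an extension of \<open>W\<close> by \<open>Y'\<close> with class
  \<open>\<beta>\<^sub>* \<epsilon> = b2\<^sub>* b1\<^sub>* \<epsilon> = 0\<close>. So \<open>F\<close> is \<open>Y' \<oplus> W\<close>. The \<open>Y'\<close>-component of \<open>h\<close> and \<open>b2\<close> have the same composite with \<open>b1\<close>, hence
  differ by a map through \<open>W\<close>, and \<open>b2\<close> is \<open>h\<close> followed by a split deflation \<open>Y' \<oplus> W \<rightarrow> Y'\<close>.
\<close>

lemma deflation_after_inflation:
  assumes b1: "inflation C b1" and b: "deflation C (b2 \<cdot> b1)"
    and ty: "arr C b1" "src C b1 = Y" "tgt C b1 = E" "arr C b2" "src C b2 = E" "tgt C b2 = Y'"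
  shows "deflation C b2"
proof -
  note [simp] = ty
  obtain e W \<epsilon> where T1: "etriangle C Y b1 E e W \<epsilon>" using b1 by (auto elim: inflationE)
  obtain K k \<kappa> where T2: "etriangle C K k Y (b2 \<cdot> b1) Y' \<kappa>" using b by (auto elim: deflationE)
  note [simp] = etriangleD[OF T1] etriangleD[OF T2]
  obtain m h F \<theta> w q \<eta> where T: "etriangle C K m E h F \<theta>" "etriangle C Y' w F q W \<eta>"
    and eq: "w \<cdot> (b2 \<cdot> b1) = h \<cdot> b1" "e = q \<cdot> h" "push C W (b2 \<cdot> b1) \<epsilon> = \<eta>"
    using ET4[OF T2 T1] by blast
  note [simp] = etriangleD[OF T(1)] etriangleD[OF T(2)]
  have "\<eta> = push C W b2 (push C W b1 \<epsilon>)" unfolding eq(3)[symmetric] by simp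
  also have "\<dots> = \<zero>\<^bsub>Ext C W Y'\<^esub>" by (simp add: etriangle_push_zero[OF T1] del: push_push)
  finally have eta: "\<eta> = \<zero>\<^bsub>Ext C W Y'\<^esub>" .
  obtain r where r [simp]: "arr C r" "src C r = F" "tgt C r = Y'" and r': "ident C Y' = r \<cdot> w"
    by (rule extend_along_inflation[OF T(2), of "ident C Y'" Y']) (blast | (simp; simp add: eta; fail))+
  have rw [simp]: "r \<cdot> w = ident C Y'" using r' by simp
  obtain \<sigma> where bF: "is_biproduct C Y' W F w \<sigma> r q"
    by (rule inflation_retraction_biproduct[OF T(2) r rw])
  have rhb: "r \<cdot> (h \<cdot> b1) = b2 \<cdot> b1" unfolding eq(1)[symmetric] by (simp add: reassoc[OF rw])
  obtain x where x [simp]: "arr C x" "src C x = W" "tgt C x = Y'" and x': "b2 \<boxplus> \<boxminus> (r \<cdot> h) = x \<cdot> e"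
    by (rule weak_cokernel[OF T1, of "b2 \<boxplus> \<boxminus> (r \<cdot> h)" Y']) (blast | (simp add: rhb; fail))+
  have "b2 = (r \<cdot> h) \<boxplus> (b2 \<boxplus> \<boxminus> (r \<cdot> h))" by (simp add: madd_ac)
  also have "\<dots> = (r \<boxplus> x \<cdot> q) \<cdot> h" unfolding x' eq(2) by simp
  finally have b2: "b2 = (r \<boxplus> x \<cdot> q) \<cdot> h" .
  have "etriangle C W (\<sigma> \<boxplus> w \<cdot> \<boxminus> x) F (r \<boxplus> \<boxminus> (\<boxminus> x \<cdot> q)) Y' \<zero>\<^bsub>Ext C Y' W\<^esub>"
    by (rule split_etriangle_shear[OF biproduct_swap[OF bF]]) simp_all
  then have "deflation C (r \<boxplus> x \<cdot> q)" using etriangle_deflation by fastforce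
  then show ?thesis
    unfolding b2 by (intro deflation_comp etriangle_deflation[OF T(1)]) simp_all
qed

text \<open>
  The mapping cone of \<open>b\<close> along the deflation \<open>b \<cdot> a\<close> shows that \<open>(b, b a) : Y \<oplus> X \<rightarrow> Z\<close> is a
  deflation, with fibre \<open>E\<close>; it equals \<open>b\<close> after the split epimorphism \<open>(1, a)\<close>. The fibre \<open>X\<close> of
  \<open>(1, a)\<close> maps to \<open>E\<close> by a section, which by hypothesis is a direct summand inclusion and thus an
  inflation. Hence the split epimorphism can be cancelled.
\<close>

lemma wic_deflation_left_factor:
  assumes wic: "weakly_idempotent_complete C" and ba: "deflation C (b \<cdot> a)"
    and ty: "arr C a" "src C a = X" "tgt C a = Y" "arr C b" "src C b = Y" "tgt C b = Z"
  shows "deflation C b"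
proof -
  note [simp] = ty
  have [simp]: "X \<in> Obj C" "Y \<in> Obj C" "Z \<in> Obj C" using arr_Obj[OF ty(1)] arr_Obj[OF ty(4)] by simp_all
  obtain K k \<kappa> where T: "etriangle C K k X (b \<cdot> a) Z \<kappa>" using ba by (auto elim: deflationE)
  obtain s E t c where m: "mapping_cone C E (\<boxminus> t) Y c X b (b \<cdot> a) Z (push C Z s \<kappa>)"
    by (rule mapping_cone_exists_dual[OF T ty(4-6)])
  obtain P i j p q where bp: "is_biproduct C Y X P i j p q" using biproduct_exists[of Y X] by auto
  note [simp] = mapping_coneD[OF m] biproductD[OF bp]
  note M = mapping_cone_etriangle[OF m bp]
  let ?h = "i \<cdot> \<boxminus> t \<boxplus> j \<cdot> c" and ?m = "b \<cdot> p \<boxplus> (b \<cdot> a) \<cdot> q"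
  have S: "etriangle C X (j \<boxplus> i \<cdot> \<boxminus> a) P (p \<boxplus> \<boxminus> (\<boxminus> a \<cdot> q)) Y \<zero>\<^bsub>Ext C Y X\<^esub>"
    by (rule split_etriangle_shear[OF biproduct_swap[OF bp]]) simp_all
  obtain q0 where q0 [simp]: "arr C q0" "src C q0 = X" "tgt C q0 = E" and hq: "j \<boxplus> i \<cdot> \<boxminus> a = ?h \<cdot> q0"
    by (rule weak_kernel[OF M, of "j \<boxplus> i \<cdot> \<boxminus> a" X]) (blast | (simp; fail))+
  have "(q \<cdot> ?h) \<cdot> q0 = q \<cdot> (j \<boxplus> i \<cdot> \<boxminus> a)" unfolding hq by simp
  then have "(q \<cdot> ?h) \<cdot> q0 = ident C X" by simp
  then obtain D l w where bD: "is_biproduct C X D E q0 l (q \<cdot> ?h) w"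
    using weakly_idempotent_complete_biproduct[OF wic, of q0 X E "q \<cdot> ?h"] by auto
  show ?thesis
  proof (rule deflation_cancel_split[OF realize_zero[OF bD] M S[unfolded hq]])
    show "(p \<boxplus> \<boxminus> (\<boxminus> a \<cdot> q)) \<cdot> i = ident C Y" by simp
    show "?m = b \<cdot> (p \<boxplus> \<boxminus> (\<boxminus> a \<cdot> q))" by simp
  qed simp_all
qed

lemma opp_weakly_idempotent_complete:
  assumes "weakly_idempotent_complete C"
  shows "weakly_idempotent_complete (opp C)"
  unfolding weakly_idempotent_complete_def
proof (intro ballI allI impI)
  interpret op: extriangulated_category "opp C" by (rule opp_extriangulated_category)
  fix A B s assume "A \<in> Obj (opp C)" "B \<in> Obj (opp C)" "is_section (opp C) A B s"
  then obtain r where "A \<in> Obj C" "B \<in> Obj C" "arr C s" "src C s = B" "tgt C s = A"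
    "arr C r" "src C r = A" "tgt C r = B" "s \<cdot> r = ident C A"
    unfolding is_section_def by (auto simp: Hom_iff)
  then obtain Q k c where "is_biproduct C A Q B r k s c"
    using weakly_idempotent_complete_biproduct[OF assms, of r A B s] by blast
  then have "is_biproduct (opp C) A Q B s c r k" by simp
  then show "\<exists>Q c. is_cokernel (opp C) A B s Q c" using op.biproduct_cokernel by blast
qed

lemma wic_inflation_right_factor:
  assumes wic: "weakly_idempotent_complete C" and ba: "inflation C (b \<cdot> a)"
    and ty: "arr C a" "arr C b" "src C b = tgt C a"
  shows "inflation C a"
  using extriangulated_category.wic_deflation_left_factor[OF opp_extriangulated_category
      opp_weakly_idempotent_complete[OF wic], of a b] assms by simp

end

section \<open>Homotopic morphisms of triangles\<close>

theorem theorem1p1: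
  fixes C :: "('o, 'm, 'e, 'z) extri_scheme"
    and X Y Z X' Y' Z' :: 'o
    and f g f' g' \<alpha> \<beta> \<gamma> :: 'm
    and \<delta> \<delta>' :: 'e
  assumes "extriangulated_category C"
    and "etriangle_morphism C (X, f, Y, g, Z, \<delta>) (X', f', Y', g', Z', \<delta>') (\<alpha>, \<beta>, \<gamma>)"
  shows "\<exists>\<alpha>' \<beta>' \<gamma>'.
    homotopic C (X, f, Y, g, Z, \<delta>) (X', f', Y', g', Z', \<delta>') (\<alpha>', \<beta>, \<gamma>) \<and>
    homotopic C (X, f, Y, g, Z, \<delta>) (X', f', Y', g', Z', \<delta>') (\<alpha>, \<beta>', \<gamma>) \<and>
    homotopic C (X, f, Y, g, Z, \<delta>) (X', f', Y', g', Z', \<delta>') (\<alpha>, \<beta>, \<gamma>') \<and>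
    (inflation C \<alpha> \<and> deflation C \<alpha> \<and> inflation C \<gamma> \<and> deflation C \<gamma>
      \<longrightarrow> inflation C \<beta>' \<and> deflation C \<beta>') \<and>
    (inflation C \<alpha> \<and> deflation C \<alpha> \<and> inflation C \<gamma> \<longrightarrow> inflation C \<beta>') \<and>
    (inflation C \<alpha> \<and> inflation C \<gamma> \<and> deflation C \<gamma> \<longrightarrow> inflation C \<beta>') \<and>
    (inflation C \<alpha> \<and> inflation C \<gamma> \<longrightarrow> inflation C \<beta>') \<and>
    (inflation C \<alpha> \<and> deflation C \<alpha> \<and> inflation C \<beta> \<and> deflation C \<beta> \<longrightarrow> deflation C \<gamma>') \<and>
    (inflation C \<alpha> \<and> deflation C \<alpha> \<and> deflation C \<beta> \<longrightarrow> deflation C \<gamma>') \<and>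
    (inflation C \<alpha> \<and> inflation C \<beta> \<and> deflation C \<beta> \<longrightarrow> deflation C \<gamma>') \<and>
    (inflation C \<alpha> \<and> deflation C \<beta> \<longrightarrow> deflation C \<gamma>') \<and>
    (weakly_idempotent_complete C \<longrightarrow>
      (deflation C \<alpha> \<and> inflation C \<beta> \<and> deflation C \<beta>
        \<longrightarrow> deflation C \<gamma>' \<and> inflation C \<alpha> \<and> deflation C \<alpha>) \<and>
      (deflation C \<alpha> \<and> deflation C \<beta> \<longrightarrow> deflation C \<gamma>'))"
proof -
  interpret extriangulated_category C by (rule assms(1))
  have t: "etriangle C X f Y g Z \<delta>" and t': "etriangle C X' f' Y' g' Z' \<delta>'"
    and c: "\<beta> \<cdot>\<^bsub>C\<^esub> f = f' \<cdot>\<^bsub>C\<^esub> \<alpha>" "g' \<cdot>\<^bsub>C\<^esub> \<beta> = \<gamma> \<cdot>\<^bsub>C\<^esub> g" and e: "push C Z \<alpha> \<delta> = pull C X' \<gamma> \<delta>'"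
    using assms(2) by simp_all
  note [simp] = etriangleD[OF t] etriangleD[OF t']
  have a: "arr C \<alpha>" "src C \<alpha> = X" "tgt C \<alpha> = X'" and b: "arr C \<beta>" "src C \<beta> = Y" "tgt C \<beta> = Y'"
    and g: "arr C \<gamma>" "src C \<gamma> = Z" "tgt C \<gamma> = Z'"
    using assms(2) by (simp_all add: Hom_iff)
  note [simp] = a b g
  obtain \<alpha>' s1 E1 t1 \<eta>1 b11 b12 where
    h1: "homotopy_factorization C X f Y g Z \<delta> X' f' Y' g' Z' \<delta>' \<alpha>' \<gamma> s1 E1 t1 \<eta>1 b11 b12" "\<beta> = b12 \<cdot>\<^bsub>C\<^esub> b11"
    by (rule homotopy_factorization_left[OF t t' g b c(2)])
  obtain s2 E2 t2 \<eta>2 b1 b2 where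
    h2: "homotopy_factorization C X f Y g Z \<delta> X' f' Y' g' Z' \<delta>' \<alpha> \<gamma> s2 E2 t2 \<eta>2 b1 b2"
    by (rule homotopy_factorization_middle[OF t t' a g e])
  obtain \<gamma>' s3 E3 t3 \<eta>3 b31 b32 where
    h3: "homotopy_factorization C X f Y g Z \<delta> X' f' Y' g' Z' \<delta>' \<alpha> \<gamma>' s3 E3 t3 \<eta>3 b31 b32" "\<beta> = b32 \<cdot>\<^bsub>C\<^esub> b31"
    by (rule homotopy_factorization_right[OF t t' a b c(1)])
  have [simp]: "arr C b1" "src C b1 = Y" "tgt C b1 = E2" "arr C b2" "src C b2 = E2" "tgt C b2 = Y'"
    "arr C b31" "src C b31 = Y" "tgt C b31 = E3" "arr C b32" "src C b32 = E3" "tgt C b32 = Y'"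
    "arr C \<gamma>'" "src C \<gamma>' = Z" "tgt C \<gamma>' = Z'"
    using h2 h3(1) unfolding homotopy_factorization_def by (auto simp: mor_iff)
  have infl: "inflation C (b2 \<cdot>\<^bsub>C\<^esub> b1)" if "inflation C \<alpha>" "inflation C \<gamma>"
    using that homotopy_factorization_first(1)[OF h2] homotopy_factorization_second(1)[OF h2]
    by (intro inflation_comp) simp_all
  have defl: "deflation C (b2 \<cdot>\<^bsub>C\<^esub> b1)" if "deflation C \<alpha>" "deflation C \<gamma>"
    using that homotopy_factorization_first(2)[OF h2] homotopy_factorization_second(2)[OF h2]
    by (intro deflation_comp) simp_all
  have right: "deflation C \<gamma>'" if "inflation C \<alpha>" "deflation C \<beta>"
  proof (rule homotopy_factorization_first(3)[OF h3(1)], rule deflation_after_inflation)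
    show "inflation C b31" by (rule homotopy_factorization_first(1)[OF h3(1) that(1)])
    show "deflation C (b32 \<cdot>\<^bsub>C\<^esub> b31)" using that(2) unfolding h3(2) .
  qed simp_all
  have "etriangle_morphism C (X, f, Y, g, Z, \<delta>) (X', f', Y', g', Z', \<delta>') (\<alpha>, \<beta>, \<gamma>')"
    using homotopy_factorization_homotopic[OF h3(1)] unfolding h3(2) homotopic.simps by blast
  then have c': "g' \<cdot>\<^bsub>C\<^esub> \<beta> = \<gamma>' \<cdot>\<^bsub>C\<^esub> g" by simp
  have wic1: "deflation C \<gamma>'" if "weakly_idempotent_complete C" "deflation C \<beta>"
  proof (rule wic_deflation_left_factor[OF that(1)])
    have "deflation C (g' \<cdot>\<^bsub>C\<^esub> \<beta>)"
      by (rule deflation_comp[OF that(2) etriangle_deflation[OF t']]) simp_all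
    then show "deflation C (\<gamma>' \<cdot>\<^bsub>C\<^esub> g)" unfolding c' .
  qed simp_all
  have wic2: "inflation C \<alpha>" if "weakly_idempotent_complete C" "inflation C \<beta>"
  proof (rule wic_inflation_right_factor[OF that(1)])
    have "inflation C (\<beta> \<cdot>\<^bsub>C\<^esub> f)"
      by (rule inflation_comp[OF etriangle_inflation[OF t] that(2)]) simp_all
    then show "inflation C (f' \<cdot>\<^bsub>C\<^esub> \<alpha>)" unfolding c(1) .
  qed simp_all
  show ?thesis
    using homotopy_factorization_homotopic[OF h1(1)] homotopy_factorization_homotopic[OF h2]
      homotopy_factorization_homotopic[OF h3(1)] infl defl right wic1 wic2
    unfolding h1(2)[symmetric] h3(2)[symmetric] by blast
qed

end
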